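(* Let $n\ge2$, $0<\lambda\le\Lambda$, $\tilde n=\frac{\lambda}{\Lambda}(n-1)+1$. Assume $\tilde n\ge 2$ and $p,q>0$. Then there does not exist any nontrivial nonnegative (viscosity) supersolution $(u,v)$ of the system $$\begin{cases}\mathcal M^+_{\lambda,\Lambda}(D^2u)+v^p=0 & \text{in }\mathbb R^n_+,\\ \mathcal M^+_{\lambda,\Lambda}(D^2v)+u^q=0 & \text{in }\mathbb R^n_+\end{cases}$$ (no boundary condition is imposed), provided one of the following holds: (1) $pq>1$ and, moreover, $\frac{2(p+1)}{pq-1}>\tilde n-1$ or $\frac{2(q+1)}{pq-1}>\tilde n-1$; (2) $\frac{2(p+1)}{pq-1}=\tilde n-1$ and $\frac{2(q+1)}{pq-1}=\tilde n-1$; (3) $pq=1$.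
   Context: $\mathbb R^n_+=\{x=(x',x_n)\in\mathbb R^{n-1}\times\mathbb R : x_n>0\}$. For $0<\lambda\le\Lambda$ and a real symmetric $n\times n$ matrix $M$ with eigenvalues $e_1,\dots,e_n$, the Pucci maximal operator is $\mathcal M^+_{\lambda,\Lambda}(M)=\Lambda\sum_{e_i>0}e_i+\lambda\sum_{e_i<0}e_i$. Viscosity supersolutions: a nonnegative supersolution of the system is a pair $(u,v)$ of continuous functions $u,v:\mathbb R^n_+\to[0,\infty)$ such that: whenever $x_0\in\mathbb R^n_+$, $\phi\in C^2(\mathbb R^n_+)$ and $u-\phi$ has a local minimum at $x_0$, one has $\mathcal M^+_{\lambda,\Lambda}(D^2\phi(x_0))+v(x_0)^p\le 0$; and whenever $v-\phi$ has a local minimum at $x_0$, one has $\mathcal M^+_{\lambda,\Lambda}(D^2\phi(x_0))+u(x_0)^q\le 0$. Nontrivial means $(u,v)\not\equiv(0,0)$. *)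

theory Defs
  imports "HOL-Analysis.Analysis" "HOL-Computational_Algebra.Polynomial"
begin

text \<open>The open half-space, with the coordinate \<open>k\<close> in the role of \<open>x\<^sub>n\<close>.\<close>

definition half_space :: "'n::finite \<Rightarrow> (real ^ 'n) set" where
  "half_space k = {x. x $ k > 0}"

definition charpoly :: "real ^ 'n ^ 'n \<Rightarrow> real poly" where
  "charpoly M = det ((\<chi> i j. (if i = j then [:0, 1:] else 0) - [:M $ i $ j:]) :: real poly ^ 'n ^ 'n)"

text \<open>
  The real eigenvalues with algebraic multiplicity. For symmetric \<open>M\<close> these are all \<open>n\<close>
  eigenvalues; \<open>pucci_max\<close> below is meaningful for symmetric \<open>M\<close> only, and is only applied
  to Hessians of \<open>C\<^sup>2\<close> functions.
\<close>

definition eigenvalues_mset :: "real ^ 'n ^ 'n \<Rightarrow> real multiset" where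
  "eigenvalues_mset M = proots (charpoly M)"

definition pucci_max :: "real \<Rightarrow> real \<Rightarrow> real ^ 'n ^ 'n \<Rightarrow> real" where
  "pucci_max lam Lam M =
     Lam * (\<Sum>e\<in>#filter_mset (\<lambda>e. e > 0) (eigenvalues_mset M). e)
     + lam * (\<Sum>e\<in>#filter_mset (\<lambda>e. e < 0) (eigenvalues_mset M). e)"

definition partial_deriv :: "'n \<Rightarrow> (real ^ 'n::finite \<Rightarrow> real) \<Rightarrow> real ^ 'n \<Rightarrow> real" where
  "partial_deriv i f x = frechet_derivative f (at x) (axis i 1)"

definition hessian :: "(real ^ 'n::finite \<Rightarrow> real) \<Rightarrow> real ^ 'n \<Rightarrow> real ^ 'n ^ 'n" where
  "hessian f x = (\<chi> i j. partial_deriv i (partial_deriv j f) x)"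

text \<open>
  Meant for open \<open>S\<close>. Differentiability guarantees that the partial derivatives, which are read
  off from the total function \<open>frechet_derivative\<close>, are genuine.
\<close>

definition C2_on :: "(real ^ 'n::finite) set \<Rightarrow> (real ^ 'n \<Rightarrow> real) \<Rightarrow> bool" where
  "C2_on S f \<longleftrightarrow>
     f differentiable_on S \<and>
     (\<forall>i. partial_deriv i f differentiable_on S) \<and>
     (\<forall>i j. continuous_on S (partial_deriv i (partial_deriv j f)))"

definition local_min_at :: "(real ^ 'n::finite \<Rightarrow> real) \<Rightarrow> real ^ 'n \<Rightarrow> bool" where
  "local_min_at f x0 \<longleftrightarrow> (\<forall>\<^sub>F x in nhds x0. f x0 \<le> f x)"

text \<open>
  Viscosity sense of \<open>M\<^sup>+(D\<^sup>2w) + f \<le> 0\<close> in the open set \<open>S\<close>; the values of \<open>w\<close>, \<open>f\<close> and of the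
  test functions outside \<open>S\<close> play no role.
\<close>

definition visc_supersol ::
  "real \<Rightarrow> real \<Rightarrow> (real ^ 'n::finite) set \<Rightarrow> (real ^ 'n \<Rightarrow> real) \<Rightarrow> (real ^ 'n \<Rightarrow> real) \<Rightarrow> bool" where
  "visc_supersol lam Lam S w f \<longleftrightarrow>
     (\<forall>x0\<in>S. \<forall>\<phi>. C2_on S \<phi> \<and> local_min_at (\<lambda>x. w x - \<phi> x) x0 \<longrightarrow>
        pucci_max lam Lam (hessian \<phi> x0) + f x0 \<le> 0)"

definition nonneg_supersolution ::
  "real \<Rightarrow> real \<Rightarrow> real \<Rightarrow> real \<Rightarrow> (real ^ 'n::finite) set \<Rightarrow>
     (real ^ 'n \<Rightarrow> real) \<Rightarrow> (real ^ 'n \<Rightarrow> real) \<Rightarrow> bool" where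
  "nonneg_supersolution lam Lam p q S u v \<longleftrightarrow>
     continuous_on S u \<and> continuous_on S v \<and>
     (\<forall>x\<in>S. 0 \<le> u x \<and> 0 \<le> v x) \<and>
     visc_supersol lam Lam S u (\<lambda>x. v x powr p) \<and>
     visc_supersol lam Lam S v (\<lambda>x. u x powr q)"

end

theory Submission
  imports Defs
begin

text \<open>
  For a unit vector \<open>\<theta>\<close> the Pucci operator dominates \<open>tr (A M)\<close> with
  \<open>A = lam I + (Lam - lam) \<theta> \<theta>\<^sup>T\<close>. With \<open>\<theta> = y / |y|\<close> this linear operator annihilates
  \<open>y\<^sub>n |y|^(-nt)\<close>, so such functions, slightly perturbed, can be slid under a
  supersolution. Put \<open>U(R) = min u\<close> over the ball of radius \<open>R / 2\<close> about \<open>R e\<^sub>n\<close>,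
  and likewise \<open>V(R)\<close> for \<open>v\<close>.

  A radial exponential barrier on that ball gives \<open>U(R) \<ge> c R\<^sup>2 V(R)^p\<close> and the same with the roles
  exchanged, hence \<open>U(R) \<ge> c R^(2 + 2 p) U(R)^(p q)\<close>. For \<open>p q = 1\<close> this is absurd as \<open>R \<rightarrow> \<infinity>\<close>. For
  \<open>p q > 1\<close> it forces \<open>U(R) \<le> C R^(-2 (p + 1) / (p q - 1))\<close>, whereas comparison with the homogeneous
  solution in an exterior domain gives \<open>U(R) \<ge> c R^(1 - nt)\<close>. In the critical case, where the two
  powers agree, inserting the lower bound of \<open>v\<close> as a source term improves the bound on \<open>U\<close> by a
  factor \<open>ln R\<close>.
\<close>

text \<open>The maximal operator is the supremum of tr (A M) over lam I \<le> A \<le> Lam I. Hence a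
  strict subsolution for one such A, chosen afresh at every point, is a strict subsolution for the
  nonlinear operator, and no eigenvalue of a barrier's Hessian has to be computed. With \<theta>
  radial, the radial second derivative has weight Lam and the n - 1 tangential ones have weight lam.
  On radial functions, and on y_n times radial functions, the result is Lam times the Laplacian in
  the fictitious dimension nt, for which y_n |y|^(-nt) is the Poisson kernel of a half-space.
  Supersolutions are only ever compared with explicit smooth functions, so touching at a minimum
  suffices and no comparison principle between two viscosity solutions enters. The two equalities of
  the critical case force p = q and p (nt - 1) = nt + 1. The source (y_n |y|^(-nt))^p then has the
  homogeneity -nt - 1 of the second derivatives of y_n |y|^(-nt); this resonance produces the
  logarithm.\<close>

subsection \<open>Eigenvalues of symmetric matrices\<close>

lemma linear_term_zero_if_quadratic_nonpos:
  fixes a b :: real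
  assumes "\<And>t. 2 * t * a + t\<^sup>2 * b \<le> 0"
  shows "a = 0"
proof (rule ccontr)
  assume a: "a \<noteq> 0"
  \<comment> \<open>Small enough for the linear term to win: substituting
    \<open>a = t * (1 + \<bar>b\<bar>)\<close> turns the expression into a positive multiple of
    \<open>t\<^sup>2\<close>.\<close>
  define t where "t = a / (1 + \<bar>b\<bar>)"
  have p: "1 + \<bar>b\<bar> > 0" by simp
  have "a = t * (1 + \<bar>b\<bar>)" using p by (simp add: t_def)
  then have "2 * t * a + t\<^sup>2 * b = t\<^sup>2 * (2 + 2 * \<bar>b\<bar> + b)"
    by (simp add: algebra_simps power2_eq_square)
  moreover have "t \<noteq> 0" using a p by (simp add: t_def)
  ultimately have "2 * t * a + t\<^sup>2 * b > 0" by simp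
  with assms[of t] show False by simp
qed

text \<open>A maximiser v of the Rayleigh quotient on the unit sphere of S is an eigenvector: the
  residual \<open>w = f v - \<mu> *\<^sub>R v\<close> lies in S, and moving v along w has
  first-order effect proportional to \<open>w \<bullet> w\<close>, which must vanish. The invariant
  subspace is there so that the lemma applies to orthogonal complements.\<close>

lemma self_adjoint_has_eigenvector:
  fixes f :: "'a::euclidean_space \<Rightarrow> 'a"
  assumes lin: "linear f" and sym: "\<And>x y. f x \<bullet> y = x \<bullet> f y"
    and S: "subspace S" and inv: "\<And>x. x \<in> S \<Longrightarrow> f x \<in> S" and ne: "x0 \<in> S" "x0 \<noteq> 0"
  obtains v \<mu> where "v \<in> S" "norm v = 1" "f v = \<mu> *\<^sub>R v"
proof -
  let ?K = "S \<inter> sphere 0 1"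
  have "compact ?K" using closed_subspace[OF S] by (simp add: closed_Int_compact)
  moreover have "x0 /\<^sub>R norm x0 \<in> ?K" using S ne by (simp add: subspace_scale)
  moreover have "continuous_on ?K (\<lambda>x. x \<bullet> f x)"
    using lin by (intro continuous_intros linear_continuous_on linear_conv_bounded_linear[THEN iffD1])
  ultimately obtain v where v: "v \<in> ?K" and vmax: "\<And>x. x \<in> ?K \<Longrightarrow> x \<bullet> f x \<le> v \<bullet> f v"
    using continuous_attains_sup[of ?K "\<lambda>x. x \<bullet> f x"] by (metis empty_iff)
  define \<mu> where "\<mu> = v \<bullet> f v"
  have le: "x \<bullet> f x \<le> \<mu> * (x \<bullet> x)" if "x \<in> S" for x
  proof (cases "x = 0")
    case False
    have "x /\<^sub>R norm x \<in> ?K" using S that False by (simp add: subspace_scale)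
    from vmax[OF this] have "(x \<bullet> f x) / (norm x)\<^sup>2 \<le> \<mu>"
      using lin by (simp add: linear_scale \<mu>_def power2_eq_square divide_simps)
    then show ?thesis using False by (simp add: divide_simps power2_norm_eq_inner)
  qed (simp add: linear_0[OF lin])
  define w where "w = f v - \<mu> *\<^sub>R v"
  have wS: "w \<in> S" using v inv S by (simp add: w_def subspace_diff subspace_scale)
  have "2 * t * (w \<bullet> w) + t\<^sup>2 * (w \<bullet> f w - \<mu> * (w \<bullet> w)) \<le> 0" for t
  proof -
    have "v + t *\<^sub>R w \<in> S" using v wS S by (simp add: subspace_add subspace_scale)
    note q = le[OF this]
    have vf: "v \<bullet> f w = w \<bullet> f v" using sym[of v w] by (simp add: inner_commute)
    have vv: "v \<bullet> v = 1" using v by (simp add: norm_eq_1)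
    have e1: "(v + t *\<^sub>R w) \<bullet> f (v + t *\<^sub>R w) = \<mu> + 2 * t * (w \<bullet> f v) + t\<^sup>2 * (w \<bullet> f w)"
      using vf by (simp add: linear_add[OF lin] linear_scale[OF lin] inner_add_left inner_add_right
           \<mu>_def power2_eq_square algebra_simps)
    have e2: "(v + t *\<^sub>R w) \<bullet> (v + t *\<^sub>R w) = 1 + 2 * t * (w \<bullet> v) + t\<^sup>2 * (w \<bullet> w)"
      using vv by (simp add: inner_add_left inner_add_right power2_eq_square inner_commute algebra_simps)
    have e3: "w \<bullet> f v = w \<bullet> w + \<mu> * (w \<bullet> v)"
    proof -
      have "w \<bullet> w = w \<bullet> (f v - \<mu> *\<^sub>R v)" by (simp add: w_def)
      then show ?thesis by (simp add: inner_diff_right)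
    qed
    show ?thesis using q unfolding e1 e2 e3 by (simp add: algebra_simps)
  qed
  then have "w \<bullet> w = 0" by (rule linear_term_zero_if_quadratic_nonpos)
  then have "f v = \<mu> *\<^sub>R v" by (simp add: w_def)
  with v show ?thesis by (intro that) auto
qed

text \<open>An orthonormal family of eigenvectors of maximal cardinality spans: its orthogonal
  complement is invariant, so a nonzero vector there would yield one more eigenvector.\<close>

lemma self_adjoint_orthonormal_eigenbasis:
  fixes f :: "'a::euclidean_space \<Rightarrow> 'a"
  assumes lin: "linear f" and sym: "\<And>x y. f x \<bullet> y = x \<bullet> f y"
  obtains B where "pairwise orthogonal B" "\<And>b. b \<in> B \<Longrightarrow> norm b = 1"
    "finite B" "card B = DIM('a)" "\<And>b. b \<in> B \<Longrightarrow> \<exists>\<mu>. f b = \<mu> *\<^sub>R b"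
proof -
  define P where "P B \<longleftrightarrow> pairwise orthogonal B \<and> (\<forall>b\<in>B. norm b = 1 \<and> (\<exists>\<mu>. f b = \<mu> *\<^sub>R b))" for B
  have ind: "finite B \<and> card B \<le> DIM('a) \<and> independent B" if "P B" for B
  proof -
    have "independent B"
      using that unfolding P_def by (intro pairwise_orthogonal_independent) auto
    then show ?thesis using independent_bound by auto
  qed
  have "P {}" by (simp add: P_def)
  then obtain B where B: "P B" and mx: "\<And>C. P C \<Longrightarrow> card C \<le> card B"
  proof -
    have "\<forall>C. P C \<longrightarrow> card C < Suc DIM('a)" using ind by (auto simp: less_Suc_eq_le)
    from ex_has_greatest_nat[OF \<open>P {}\<close> this] show ?thesis using that by blast
  qed
  define S where "S = {x. \<forall>b\<in>B. orthogonal b x}"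
  have S: "subspace S" unfolding S_def by (auto simp: subspace_def orthogonal_def inner_add_right)
  have inv: "f x \<in> S" if "x \<in> S" for x
    unfolding S_def mem_Collect_eq
  proof
    fix b assume b: "b \<in> B"
    then obtain \<mu> where "f b = \<mu> *\<^sub>R b" using B by (auto simp: P_def)
    then have "b \<bullet> f x = \<mu> * (b \<bullet> x)" using sym[of b x] by simp
    then show "orthogonal b (f x)" using that b by (simp add: S_def orthogonal_def)
  qed
  have S0: "S \<subseteq> {0}"
  proof (rule ccontr)
    assume "\<not> S \<subseteq> {0}"
    then obtain x0 where "x0 \<in> S" "x0 \<noteq> 0" by auto
    from self_adjoint_has_eigenvector[OF lin sym S inv this]
    obtain v \<mu> where v: "v \<in> S" "norm v = 1" "f v = \<mu> *\<^sub>R v" by metis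
    have "v \<notin> B" using v by (auto simp: S_def orthogonal_def norm_eq_1)
    moreover have "P (insert v B)"
      using B v unfolding P_def S_def by (auto simp: pairwise_insert orthogonal_commute)
    ultimately show False using mx[of "insert v B"] ind[OF B] by simp
  qed
  have "span B = UNIV"
  proof (rule ccontr)
    assume "span B \<noteq> UNIV"
    then obtain a where a: "a \<noteq> 0" "\<And>x. x \<in> span B \<Longrightarrow> a \<bullet> x = 0"
      using span_not_univ_subset_hyperplane by blast
    then have "a \<in> S" by (auto simp: S_def orthogonal_def inner_commute span_base)
    with S0 a show False by auto
  qed
  then have "card B = DIM('a)" using ind[OF B] by (metis dim_UNIV dim_eq_card_independent dim_span)
  with B ind[OF B] show ?thesis by (intro that[of B]) (auto simp: P_def)
qed

lemma symmetric_matrix_diagonalizable: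
  fixes M :: "real^'n^'n"
  assumes sym: "transpose M = M"
  obtains P :: "real^'n^'n" and d :: "'n \<Rightarrow> real"
  where "orthogonal_matrix P" "M ** P = P ** (\<chi> i j. if i = j then d i else 0)"
proof -
  have "(M *v x) \<bullet> y = x \<bullet> (M *v y)" for x y
    by (metis dot_lmul_matrix inner_commute sym transpose_matrix_vector)
  from self_adjoint_orthonormal_eigenbasis[OF matrix_vector_mul_linear this]
  obtain B where B: "pairwise orthogonal B" "\<And>b. b \<in> B \<Longrightarrow> norm b = 1"
    "finite B" "card B = DIM(real^'n)" "\<And>b. b \<in> B \<Longrightarrow> \<exists>\<mu>. M *v b = \<mu> *\<^sub>R b" by metis
  have "card B = CARD('n)" using B by simp
  then obtain g :: "'n \<Rightarrow> real^'n" where g: "bij_betw g UNIV B"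
    using B(3) by (metis finite_same_card_bij finite)
  then have gB: "g i \<in> B" for i by (auto simp: bij_betw_def)
  then have "\<forall>i. \<exists>\<mu>. M *v g i = \<mu> *\<^sub>R g i" using B(5) by blast
  then obtain d where d: "\<And>i. M *v g i = d i *\<^sub>R g i" by metis
  define P :: "real^'n^'n" where "P = (\<chi> i j. g j $ i)"
  have col: "column j P = g j" for j by (simp add: P_def column_def vec_eq_iff)
  have "orthogonal_matrix P"
    unfolding orthogonal_matrix_orthonormal_columns col
  proof (intro conjI allI impI)
    fix i j :: 'n assume "i \<noteq> j"
    then have "g i \<noteq> g j" using g by (auto simp: bij_betw_def inj_eq)
    then show "orthogonal (g i) (g j)" using B(1) gB by (auto simp: pairwise_def)
  qed (use B(2) gB in auto)
  moreover have "M ** P = P ** (\<chi> i j. if i = j then d i else 0)"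
  proof (simp add: vec_eq_iff, intro allI)
    fix i j
    have "(M ** P) $ i $ j = (M *v g j) $ i"
      by (simp add: matrix_matrix_mult_def matrix_vector_mult_def P_def)
    also have "\<dots> = d j * g j $ i" by (simp add: d)
    also have "\<dots> = (P ** (\<chi> i j. if i = j then d i else 0)) $ i $ j"
      by (simp add: matrix_matrix_mult_def P_def if_distrib[of "\<lambda>x. _ * x"] cong: if_cong)
    finally show "(M ** P) $ i $ j = (P ** (\<chi> i j. if i = j then d i else 0)) $ i $ j" .
  qed
  ultimately show ?thesis by (rule that)
qed

text \<open>The intertwining relation lifts to polynomial matrices: with \<open>C\<close> embedding
  constants and \<open>X A\<close> standing for the matrix x I - A, it reads
  \<open>X M ** C P = C P ** X D\<close>. Determinants are multiplicative, and
  \<open>det (C P)\<close> cancels since it has an inverse.\<close>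

lemma charpoly_eq_if_similar:
  fixes M P D :: "real^'n^'n"
  assumes eq: "M ** P = P ** D" and inv: "P ** Q = mat 1"
  shows "charpoly M = charpoly D"
proof -
  define C :: "real^'n^'n \<Rightarrow> real poly^'n^'n" where "C A = (\<chi> i j. [:A $ i $ j:])" for A
  define X :: "real^'n^'n \<Rightarrow> real poly^'n^'n"
    where "X A = (\<chi> i j. (if i = j then [:0, 1:] else 0) - [:A $ i $ j:])" for A
  have sumC: "(\<Sum>k\<in>K. [:h k:]) = [:\<Sum>k\<in>K. h k:]" for h :: "'n \<Rightarrow> real" and K
    by (induction K rule: infinite_finite_induct) auto
  have Cmul: "C A ** C B = C (A ** B)" for A B
    by (simp add: C_def matrix_matrix_mult_def vec_eq_iff mult.commute flip: sumC)
  have h: "[:b:] * ((if Q then [:0, 1:] else 0) - [:a:]) = (if Q then [:0, b:] else 0) - [:b * a:]"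
    "((if Q then [:0, 1:] else 0) - [:a:]) * [:b:] = (if Q then [:0, b:] else 0) - [:a * b:]"
    for a b :: real and Q by (auto simp: smult_diff_right mult.commute)
  have X1: "X A ** C B = (\<chi> i j. [:0, B $ i $ j:]) - C (A ** B)" for A B
    by (simp add: X_def C_def matrix_matrix_mult_def vec_eq_iff sum_subtractf h sumC del: mult_pCons_left mult_pCons_right)
  have X2: "C B ** X A = (\<chi> i j. [:0, B $ i $ j:]) - C (B ** A)" for A B
    by (simp add: X_def C_def matrix_matrix_mult_def vec_eq_iff sum_subtractf h sumC del: mult_pCons_left mult_pCons_right)
  have "X M ** C P = C P ** X D" by (simp add: X1 X2 eq)
  then have "det (X M) * det (C P) = det (C P) * det (X D)" by (metis det_mul)
  moreover have "C (mat 1) = mat 1" by (simp add: C_def mat_def vec_eq_iff one_pCons)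
  then have "det (C P) * det (C Q) = 1" by (metis Cmul inv det_mul det_I)
  then have "det (C P) \<noteq> 0" by auto
  ultimately have "det (X M) = det (X D)" by simp
  then show ?thesis by (simp add: charpoly_def X_def)
qed

lemma eigenvalues_mset_diagonal:
  "eigenvalues_mset (\<chi> i j. if i = j then d i else 0 :: real^'n^'n) = image_mset d (mset_set UNIV)"
proof -
  have "charpoly (\<chi> i j. if i = j then d i else 0 :: real^'n^'n) = (\<Prod>i\<in>UNIV. [:- d i, 1:])"
    unfolding charpoly_def by (subst det_diagonal) auto
  then show ?thesis
    by (simp add: eigenvalues_mset_def proots_prod sum_unfold_sum_mset)
qed

text \<open>In an eigenbasis, \<open>pucci_max lam Lam M - lam * trace M\<close> is Lam - lam times
  the sum of the positive eigenvalues. That sum dominates the quadratic form at a unit vector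
  because every squared coordinate is at most 1.\<close>

lemma pucci_max_ge:
  fixes M :: "real^'n^'n"
  assumes sym: "transpose M = M" and "0 < lam" "lam \<le> Lam" and th: "norm \<theta> = 1"
  shows "lam * trace M + (Lam - lam) * (\<theta> \<bullet> (M *v \<theta>)) \<le> pucci_max lam Lam M"
proof -
  obtain P :: "real^'n^'n" and d where P: "orthogonal_matrix P"
    and eq: "M ** P = P ** (\<chi> i j. if i = j then d i else 0)"
    using symmetric_matrix_diagonalizable[OF sym] by blast
  define D :: "real^'n^'n" where "D = (\<chi> i j. if i = j then d i else 0)"
  have PQ: "P ** transpose P = mat 1" and QP: "transpose P ** P = mat 1"
    using P by (auto simp: orthogonal_matrix_def)
  have M: "M = P ** (D ** transpose P)"
    using arg_cong[OF eq, of "\<lambda>A. A ** transpose P"] PQ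
    by (simp add: D_def flip: matrix_mul_assoc)
  have "charpoly M = charpoly D" using charpoly_eq_if_similar[OF eq PQ] by (simp add: D_def)
  then have ev: "eigenvalues_mset M = image_mset d (mset_set UNIV)"
    using eigenvalues_mset_diagonal[of d] by (simp add: eigenvalues_mset_def D_def)
  have sumf: "(\<Sum>e\<in>#filter_mset Q (eigenvalues_mset M). e) = (\<Sum>i\<in>{i. Q (d i)}. d i)" for Q
    unfolding ev by (simp add: filter_mset_image_mset sum_unfold_sum_mset image_mset.compositionality o_def)
  have tr: "trace M = (\<Sum>i\<in>UNIV. d i)"
  proof -
    have "trace M = trace (D ** transpose P ** P)" unfolding M by (rule trace_mul_sym)
    also have "\<dots> = trace D" by (simp add: QP flip: matrix_mul_assoc)
    finally show ?thesis by (simp add: trace_def D_def)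
  qed
  define \<xi> where "\<xi> = transpose P *v \<theta>"
  have "\<xi> \<bullet> \<xi> = \<theta> \<bullet> (P *v \<xi>)"
    by (metis \<xi>_def dot_lmul_matrix transpose_matrix_vector)
  also have "P *v \<xi> = \<theta>"
    unfolding \<xi>_def matrix_vector_mul_assoc PQ by simp
  finally have "\<xi> \<bullet> \<xi> = 1" using th by (simp add: norm_eq_1)
  then have n1: "(\<Sum>i\<in>UNIV. (\<xi> $ i)\<^sup>2) = 1" by (simp add: inner_vec_def power2_eq_square)
  have "\<theta> \<bullet> (M *v \<theta>) = \<theta> \<bullet> (P *v (D *v \<xi>))"
    unfolding M \<xi>_def by (simp only: matrix_vector_mul_assoc matrix_mul_assoc)
  also have "\<dots> = \<xi> \<bullet> (D *v \<xi>)" unfolding \<xi>_def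
    by (metis dot_lmul_matrix transpose_matrix_vector)
  also have "D *v \<xi> = (\<chi> i. d i * \<xi> $ i)"
    by (simp add: D_def matrix_vector_mult_def vec_eq_iff if_distrib[of "\<lambda>x. x * _"] cong: if_cong)
  also have "\<xi> \<bullet> \<dots> = (\<Sum>i\<in>UNIV. d i * (\<xi> $ i)\<^sup>2)"
    by (simp add: inner_vec_def power2_eq_square mult_ac)
  also have "\<dots> \<le> (\<Sum>i\<in>UNIV. if d i > 0 then d i else 0)"
  proof (rule sum_mono)
    fix i
    have "(\<xi> $ i)\<^sup>2 \<le> 1" unfolding n1[symmetric] by (rule member_le_sum) auto
    then show "d i * (\<xi> $ i)\<^sup>2 \<le> (if d i > 0 then d i else 0)"
      by (auto simp: mult_left_le intro: mult_nonpos_nonneg)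
  qed
  also have "\<dots> = (\<Sum>i\<in>{i. d i > 0}. d i)" by (simp add: sum.If_cases)
  finally have th': "\<theta> \<bullet> (M *v \<theta>) \<le> (\<Sum>i\<in>{i. d i > 0}. d i)" .
  have "(\<Sum>i\<in>UNIV. d i) = (\<Sum>i\<in>UNIV. (if d i > 0 then d i else 0) + (if d i < 0 then d i else 0))"
    by (rule sum.cong) auto
  then have split: "trace M = (\<Sum>i\<in>{i. d i > 0}. d i) + (\<Sum>i\<in>{i. d i < 0}. d i)"
    unfolding tr by (simp add: sum.distrib sum.If_cases)
  have "(Lam - lam) * (\<theta> \<bullet> (M *v \<theta>)) \<le> (Lam - lam) * (\<Sum>i\<in>{i. d i > 0}. d i)"
    using th' assms by (intro mult_left_mono) auto
  then show ?thesis
    unfolding pucci_max_def sumf split by (simp add: algebra_simps)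
qed

subsection \<open>Hessians of products of linear and radial functions\<close>

text \<open>A certificate with explicit gradient and Hessian that is closed under sums and
  multiples. It yields both \<open>C2_on\<close> and the value of \<open>hessian\<close>, so that
  the latter is never computed from Frechet derivatives of a concrete barrier.\<close>

definition has_hessian :: "(real^'n \<Rightarrow> real) \<Rightarrow> (real^'n \<Rightarrow> real^'n^'n) \<Rightarrow> bool" where
  "has_hessian \<phi> H \<longleftrightarrow> continuous_on UNIV H \<and> (\<forall>x. transpose (H x) = H x) \<and>
     (\<exists>G. (\<forall>x. (\<phi> has_derivative (\<lambda>h. G x \<bullet> h)) (at x)) \<and>
          (\<forall>x. (G has_derivative (\<lambda>h. H x *v h)) (at x)))"

lemma has_hessian_partials:
  assumes "has_hessian \<phi> H"
  shows "C2_on S \<phi>" "hessian \<phi> x = H x"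
proof -
  obtain G where G: "\<And>x. (\<phi> has_derivative (\<lambda>h. G x \<bullet> h)) (at x)"
    and G': "\<And>x. (G has_derivative (\<lambda>h. H x *v h)) (at x)"
    and cont: "continuous_on UNIV H" and sym: "\<And>x. transpose (H x) = H x"
    using assms by (auto simp: has_hessian_def)
  have pd: "partial_deriv i \<phi> = (\<lambda>x. G x $ i)" for i
    using frechet_derivative_at[OF G]
    by (simp add: partial_deriv_def fun_eq_iff inner_axis) (metis inner_axis inner_real_def mult.right_neutral)
  have dG: "((\<lambda>x. G x $ i) has_derivative (\<lambda>h. (H x *v h) $ i)) (at x)" for i x
    using bounded_linear.has_derivative[OF bounded_linear_vec_nth G'] .
  have pd2: "partial_deriv i (partial_deriv j \<phi>) x = H x $ j $ i" for i j x
    unfolding pd partial_deriv_def frechet_derivative_at[OF dG, symmetric]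
    by (simp add: matrix_vector_mult_basis column_def)
  have "H x $ j $ i = H x $ i $ j" for i j
    using sym[of x] by (simp add: transpose_def vec_eq_iff)
  then show "hessian \<phi> x = H x" by (simp add: hessian_def pd2 vec_eq_iff)
  show "C2_on S \<phi>"
    unfolding C2_on_def
  proof (intro conjI allI)
    show "\<phi> differentiable_on S" using G by (meson differentiableI differentiable_at_imp_differentiable_on)
    show "partial_deriv i \<phi> differentiable_on S" for i
      unfolding pd using dG by (meson differentiableI differentiable_at_imp_differentiable_on)
    show "continuous_on S (partial_deriv i (partial_deriv j \<phi>))" for i j
      unfolding pd2 by (intro continuous_intros continuous_on_subset[OF cont]) auto
  qed
qed

lemma has_hessian_add:
  assumes "has_hessian \<phi> H" "has_hessian \<psi> K"
  shows "has_hessian (\<lambda>x. \<phi> x + \<psi> x) (\<lambda>x. H x + K x)"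
proof -
  obtain G1 G2 where G: "\<And>x. (\<phi> has_derivative (\<lambda>h. G1 x \<bullet> h)) (at x)"
    "\<And>x. (G1 has_derivative (\<lambda>h. H x *v h)) (at x)"
    "\<And>x. (\<psi> has_derivative (\<lambda>h. G2 x \<bullet> h)) (at x)"
    "\<And>x. (G2 has_derivative (\<lambda>h. K x *v h)) (at x)"
    using assms by (auto simp: has_hessian_def)
  have "transpose (A + B) = transpose A + transpose B" for A B :: "real^'a^'a"
    by (simp add: transpose_def vec_eq_iff)
  then show ?thesis using assms unfolding has_hessian_def
    by (intro conjI exI[of _ "\<lambda>x. G1 x + G2 x"])
       (auto intro!: continuous_intros derivative_eq_intros G simp: inner_add_left matrix_vector_mult_add_rdistrib)
qed

lemma has_hessian_const: "has_hessian (\<lambda>x. c) (\<lambda>x. 0)"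
  unfolding has_hessian_def
  by (intro conjI exI[of _ "\<lambda>x. 0"]) (auto simp: transpose_def vec_eq_iff fun_eq_iff intro!: has_derivative_eq_rhs[OF has_derivative_const])

lemma has_hessian_cmult:
  assumes "has_hessian \<phi> H"
  shows "has_hessian (\<lambda>x. c * \<phi> x) (\<lambda>x. c *\<^sub>R H x)"
proof -
  obtain G1 where G: "\<And>x. (\<phi> has_derivative (\<lambda>h. G1 x \<bullet> h)) (at x)"
    "\<And>x. (G1 has_derivative (\<lambda>h. H x *v h)) (at x)"
    using assms by (auto simp: has_hessian_def)
  have "transpose (c *\<^sub>R A) = c *\<^sub>R transpose A" for A :: "real^'a^'a"
    by (simp add: transpose_def vec_eq_iff)
  then show ?thesis using assms unfolding has_hessian_def
    by (intro conjI exI[of _ "\<lambda>x. c *\<^sub>R G1 x"])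
       (auto intro!: continuous_intros derivative_eq_intros G simp: scaleR_matrix_vector_assoc)
qed

text \<open>The Hessian at y of the product of \<open>q (y \<bullet> e)\<close> and
  \<open>g (y \<bullet> y)\<close>. The primed functions are free parameters, tied to derivatives
  only in \<open>has_hessian_prod\<close>. Using the squared norm avoids the singularity of the norm
  at the origin.\<close>

definition prod_hess :: "real^'n \<Rightarrow> (real \<Rightarrow> real) \<Rightarrow> (real \<Rightarrow> real) \<Rightarrow> (real \<Rightarrow> real) \<Rightarrow>
    (real \<Rightarrow> real) \<Rightarrow> (real \<Rightarrow> real) \<Rightarrow> (real \<Rightarrow> real) \<Rightarrow> real^'n \<Rightarrow> real^'n^'n" where
  "prod_hess e q q' q'' g g' g'' y =
    (\<chi> i j. q'' (y \<bullet> e) * g (y \<bullet> y) * (e $ i * e $ j)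
        + 2 * q' (y \<bullet> e) * g' (y \<bullet> y) * (e $ i * y $ j + y $ i * e $ j)
        + (if i = j then 2 * q (y \<bullet> e) * g' (y \<bullet> y) else 0)
        + 4 * q (y \<bullet> e) * g'' (y \<bullet> y) * (y $ i * y $ j))"

lemma prod_hess_mult:
  "prod_hess e q q' q'' g g' g'' y *v h =
     (q'' (y \<bullet> e) * g (y \<bullet> y) * (e \<bullet> h) + 2 * q' (y \<bullet> e) * g' (y \<bullet> y) * (y \<bullet> h)) *\<^sub>R e
     + (2 * q' (y \<bullet> e) * g' (y \<bullet> y) * (e \<bullet> h) + 4 * q (y \<bullet> e) * g'' (y \<bullet> y) * (y \<bullet> h)) *\<^sub>R y
     + (2 * q (y \<bullet> e) * g' (y \<bullet> y)) *\<^sub>R h"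
proof -
  have ih: "z \<bullet> h = (\<Sum>j\<in>UNIV. z $ j * h $ j)" for z :: "real^'a"
    by (simp add: inner_vec_def)
  have *: "(\<chi> i j. A * (e $ i * e $ j) + B * (e $ i * y $ j + y $ i * e $ j)
        + (if i = j then C else 0) + D * (y $ i * y $ j)) *v h =
     (A * (e \<bullet> h) + B * (y \<bullet> h)) *\<^sub>R e + (B * (e \<bullet> h) + D * (y \<bullet> h)) *\<^sub>R y + C *\<^sub>R h" for A B C D
    unfolding vec_eq_iff
  proof
    fix i
    have "((\<chi> i j. A * (e $ i * e $ j) + B * (e $ i * y $ j + y $ i * e $ j)
        + (if i = j then C else 0) + D * (y $ i * y $ j)) *v h) $ i
      = (\<Sum>j\<in>UNIV. A * e $ i * (e $ j * h $ j) + B * e $ i * (y $ j * h $ j) + B * y $ i * (e $ j * h $ j)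
          + (if i = j then C * h $ j else 0) + D * y $ i * (y $ j * h $ j))"
      by (simp add: matrix_vector_mult_def algebra_simps if_distrib[of "\<lambda>x. _ * x"] cong: if_cong)
    also have "\<dots> = A * e $ i * (e \<bullet> h) + B * e $ i * (y \<bullet> h) + B * y $ i * (e \<bullet> h)
          + C * h $ i + D * y $ i * (y \<bullet> h)"
      by (simp add: sum.distrib ih flip: sum_distrib_left)
    finally show "((\<chi> i j. A * (e $ i * e $ j) + B * (e $ i * y $ j + y $ i * e $ j)
        + (if i = j then C else 0) + D * (y $ i * y $ j)) *v h) $ i =
     ((A * (e \<bullet> h) + B * (y \<bullet> h)) *\<^sub>R e + (B * (e \<bullet> h) + D * (y \<bullet> h)) *\<^sub>R y + C *\<^sub>R h) $ i"
      by (simp add: algebra_simps)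
  qed
  show ?thesis unfolding prod_hess_def * by simp
qed

lemma prod_hess_trace:
  assumes "norm e = 1"
  shows "trace (prod_hess e q q' q'' g g' g'' (y::real^'n)) =
     q'' (y \<bullet> e) * g (y \<bullet> y) + 4 * q' (y \<bullet> e) * g' (y \<bullet> y) * (y \<bullet> e)
     + 2 * real CARD('n) * q (y \<bullet> e) * g' (y \<bullet> y) + 4 * q (y \<bullet> e) * g'' (y \<bullet> y) * (y \<bullet> y)"
proof -
  have ih: "(\<Sum>j\<in>UNIV. z $ j * w $ j) = z \<bullet> w" for z w :: "real^'n"
    by (simp add: inner_vec_def)
  have e: "e \<bullet> e = 1" using assms by (simp add: norm_eq_1)
  show ?thesis
    by (simp add: trace_def prod_hess_def sum.distrib ih e inner_commute flip: sum_distrib_left)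
qed

text \<open>The derivatives of g are required only on the range of the squared distance, which
  admits powers and logarithms of 1 + s. They are two-sided even at s = 0, so the chain rule also
  holds at the centre a.\<close>

lemma has_hessian_prod:
  fixes e a :: "real^'n"
  assumes q: "\<And>t. (q has_real_derivative q' t) (at t)" "\<And>t. (q' has_real_derivative q'' t) (at t)"
      "continuous_on UNIV q''"
    and g: "\<And>s. s \<ge> 0 \<Longrightarrow> (g has_real_derivative g' s) (at s)"
      "\<And>s. s \<ge> 0 \<Longrightarrow> (g' has_real_derivative g'' s) (at s)" "continuous_on {0..} g''"
  shows "has_hessian (\<lambda>x. q ((x - a) \<bullet> e) * g ((x - a) \<bullet> (x - a)))
            (\<lambda>x. prod_hess e q q' q'' g g' g'' (x - a))"
proof -
  have lin: "((\<lambda>x. (x - a) \<bullet> e) has_derivative (\<lambda>h. h \<bullet> e)) (at x)" for x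
    by (auto intro!: derivative_eq_intros)
  have sq: "((\<lambda>x. (x - a) \<bullet> (x - a)) has_derivative (\<lambda>h. 2 * ((x - a) \<bullet> h))) (at x)" for x
    by (auto intro!: derivative_eq_intros simp: inner_commute)
  have dq: "((\<lambda>x. f ((x - a) \<bullet> e)) has_derivative (\<lambda>h. (h \<bullet> e) * f' ((x - a) \<bullet> e))) (at x)"
    if "\<And>t. (f has_real_derivative f' t) (at t)" for f f' x
    using has_derivative_compose[OF lin has_field_derivative_imp_has_derivative[OF that]]
    by (simp add: mult.commute)
  have dg: "((\<lambda>x. f ((x - a) \<bullet> (x - a))) has_derivative (\<lambda>h. 2 * ((x - a) \<bullet> h) * f' ((x - a) \<bullet> (x - a)))) (at x)"
    if "\<And>s. s \<ge> 0 \<Longrightarrow> (f has_real_derivative f' s) (at s)" for f f' x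
    using has_derivative_compose[OF sq has_field_derivative_imp_has_derivative[OF that]]
    by (simp add: mult.commute)
  define G where "G x = (q' ((x - a) \<bullet> e) * g ((x - a) \<bullet> (x - a))) *\<^sub>R e
      + (2 * q ((x - a) \<bullet> e) * g' ((x - a) \<bullet> (x - a))) *\<^sub>R (x - a)" for x
  have 1: "((\<lambda>x. q ((x - a) \<bullet> e) * g ((x - a) \<bullet> (x - a))) has_derivative (\<lambda>h. G x \<bullet> h)) (at x)" for x
    by (rule has_derivative_eq_rhs, rule has_derivative_mult[OF dq[OF q(1)] dg[OF g(1)]])
       (auto simp: G_def fun_eq_iff inner_add_left inner_commute algebra_simps)
  have 2: "(G has_derivative (\<lambda>h. prod_hess e q q' q'' g g' g'' (x - a) *v h)) (at x)" for x
    unfolding G_def[abs_def] prod_hess_mult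
    by (rule has_derivative_eq_rhs, (rule derivative_intros dq[OF q(1)] dq[OF q(2)] dg[OF g(1)] dg[OF g(2)] | assumption)+)
       (auto simp: fun_eq_iff inner_commute algebra_simps)
  have cq: "continuous_on UNIV q" "continuous_on UNIV q'"
    using q by (meson DERIV_isCont continuous_at_imp_continuous_on)+
  have cg: "continuous_on {0..} g" "continuous_on {0..} g'"
    using g by (meson DERIV_isCont atLeast_iff continuous_at_imp_continuous_on)+
  have c1: "continuous_on UNIV (\<lambda>x. f ((x - a) \<bullet> e))" if "continuous_on UNIV f" for f :: "real \<Rightarrow> real"
    by (rule continuous_on_compose2[OF that]) (auto intro!: continuous_intros)
  have c2: "continuous_on UNIV (\<lambda>x. f ((x - a) \<bullet> (x - a)))" if "continuous_on {0..} f" for f :: "real \<Rightarrow> real"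
    by (rule continuous_on_compose2[OF that]) (auto intro!: continuous_intros)
  have 3: "continuous_on UNIV (\<lambda>x. prod_hess e q q' q'' g g' g'' (x - a))"
    unfolding prod_hess_def
  proof (intro continuous_on_vec_lambda)
    fix i j :: 'n
    have y: "continuous_on UNIV (\<lambda>x. (x - a) $ i)" for i
      by (intro continuous_intros)
    have k: "continuous_on UNIV (\<lambda>x. if i = j then 2 * q ((x - a) \<bullet> e) * g' ((x - a) \<bullet> (x - a)) else 0)"
      using continuous_on_mult[OF c1[OF cq(1)] c2[OF cg(2)]]
      by (cases "i = j") (simp_all add: continuous_on_mult_left mult.assoc)
    show "continuous_on UNIV (\<lambda>x. q'' ((x - a) \<bullet> e) * g ((x - a) \<bullet> (x - a)) * (e $ i * e $ j)
        + 2 * q' ((x - a) \<bullet> e) * g' ((x - a) \<bullet> (x - a)) * (e $ i * (x - a) $ j + (x - a) $ i * e $ j)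
        + (if i = j then 2 * q ((x - a) \<bullet> e) * g' ((x - a) \<bullet> (x - a)) else 0)
        + 4 * q ((x - a) \<bullet> e) * g'' ((x - a) \<bullet> (x - a)) * ((x - a) $ i * (x - a) $ j))"
      by (intro continuous_on_add continuous_on_mult continuous_on_const y k
          c1[OF cq(1)] c1[OF cq(2)] c1[OF q(3)] c2[OF cg(1)] c2[OF cg(2)] c2[OF g(3)])
  qed
  have 4: "transpose (prod_hess e q q' q'' g g' g'' y) = prod_hess e q q' q'' g g' g'' y" for y
    by (auto simp: transpose_def prod_hess_def vec_eq_iff algebra_simps)
  show ?thesis unfolding has_hessian_def using 1 2 3 4 by blast
qed

text \<open>The trace of \<open>A M\<close> for the coefficient matrix \<open>A = lam I + (Lam - lam) \<theta> \<theta>\<^sup>T\<close>.\<close>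

definition lin_op :: "real \<Rightarrow> real \<Rightarrow> real^'n \<Rightarrow> real^'n^'n \<Rightarrow> real" where
  "lin_op lam Lam \<theta> M = lam * trace M + (Lam - lam) * (\<theta> \<bullet> (M *v \<theta>))"

lemma lin_op_add: "lin_op lam Lam \<theta> (A + B) = lin_op lam Lam \<theta> A + lin_op lam Lam \<theta> B"
  by (simp add: lin_op_def trace_add matrix_vector_mult_add_rdistrib inner_add_right algebra_simps)

lemma lin_op_scaleR: "lin_op lam Lam \<theta> (c *\<^sub>R A) = c * lin_op lam Lam \<theta> A"
  by (simp add: lin_op_def trace_def sum_distrib_left inner_scaleR_right algebra_simps flip: scaleR_matrix_vector_assoc)

text \<open>For \<theta> along y every inner product reduces to the norm of y and
  \<open>\<theta> \<bullet> e\<close>. The form of the hypothesis leaves \<theta> arbitrary at y =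
  0, where no direction is singled out.\<close>

lemma lin_op_prod_hess:
  fixes y :: "real^'n"
  assumes "norm e = 1" "norm \<theta> = 1" and y: "y = norm y *\<^sub>R \<theta>"
  shows "lin_op lam Lam \<theta> (prod_hess e q q' q'' g g' g'' y) =
     q'' (y \<bullet> e) * g (y \<bullet> y) * (lam + (Lam - lam) * (\<theta> \<bullet> e)\<^sup>2)
     + 4 * Lam * q' (y \<bullet> e) * g' (y \<bullet> y) * (y \<bullet> e)
     + 2 * (lam * (real CARD('n) - 1) + Lam) * q (y \<bullet> e) * g' (y \<bullet> y) + 4 * Lam * q (y \<bullet> e) * g'' (y \<bullet> y) * (y \<bullet> y)"
proof -
  have tt: "\<theta> \<bullet> \<theta> = 1" using assms by (simp add: norm_eq_1)
  define r where "r = norm y"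
  have yr: "y = r *\<^sub>R \<theta>" using y by (simp add: r_def)
  have yt: "y \<bullet> \<theta> = r" by (simp add: yr tt)
  have te: "y \<bullet> e = r * (\<theta> \<bullet> e)" by (simp add: yr)
  have yy: "y \<bullet> y = r * r" by (simp add: yr tt)
  have "\<theta> \<bullet> (prod_hess e q q' q'' g g' g'' y *v \<theta>) =
      q'' (y \<bullet> e) * g (y \<bullet> y) * (\<theta> \<bullet> e)\<^sup>2 + 4 * q' (y \<bullet> e) * g' (y \<bullet> y) * (r * (\<theta> \<bullet> e))
      + 2 * q (y \<bullet> e) * g' (y \<bullet> y) + 4 * q (y \<bullet> e) * g'' (y \<bullet> y) * (r * r)"
    unfolding prod_hess_mult
    by (simp add: inner_add_right inner_commute[of \<theta> y] inner_commute[of e \<theta>] yt tt power2_eq_square algebra_simps)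
  then show ?thesis
    unfolding lin_op_def prod_hess_trace[OF assms(1)] te[symmetric] yy[symmetric]
    by (simp add: algebra_simps)
qed

lemma lin_op_le_pucci_max_hessian:
  assumes "has_hessian \<phi> H" "0 < lam" "lam \<le> Lam" "norm \<theta> = 1"
  shows "lin_op lam Lam \<theta> (H x) \<le> pucci_max lam Lam (hessian \<phi> x)"
  unfolding has_hessian_partials(2)[OF assms(1)] lin_op_def
  using assms by (intro pucci_max_ge) (auto simp: has_hessian_def)

subsection \<open>Comparison on balls and in exterior domains\<close>

lemma has_hessian_continuous:
  assumes "has_hessian \<phi> H" shows "continuous_on S \<phi>"
proof -
  have "\<phi> differentiable_on S" using has_hessian_partials(1)[OF assms] by (auto simp: C2_on_def)
  then show ?thesis by (rule differentiable_imp_continuous_on)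
qed

text \<open>At a negative minimum of \<open>w - \<phi>\<close> over C, \<open>strict\<close> gives
  interiority, so \<open>\<phi>\<close> is an admissible test function, and at the same time
  contradicts the viscosity inequality. Boundary data and differential inequality are thus merged
  into one condition, imposed only where \<open>\<phi>\<close> exceeds w.\<close>

lemma visc_comparison:
  assumes vs: "visc_supersol lam Lam S w f" and w: "continuous_on S w"
    and C: "compact C" "C \<subseteq> S" and \<phi>: "has_hessian \<phi> H"
    and strict: "\<And>x. x \<in> C \<Longrightarrow> w x < \<phi> x \<Longrightarrow>
      x \<in> interior C \<and> 0 < pucci_max lam Lam (hessian \<phi> x) + f x"
    and x: "x \<in> C"
  shows "\<phi> x \<le> w x"
proof (rule ccontr)
  assume "\<not> \<phi> x \<le> w x"
  have "continuous_on C (\<lambda>x. w x - \<phi> x)"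
    using continuous_on_subset[OF w C(2)] has_hessian_continuous[OF \<phi>] by (intro continuous_intros)
  then obtain x0 where x0: "x0 \<in> C" and mn: "\<And>z. z \<in> C \<Longrightarrow> w x0 - \<phi> x0 \<le> w z - \<phi> z"
    using continuous_attains_inf[OF C(1), of "\<lambda>x. w x - \<phi> x"] x by blast
  have "w x0 < \<phi> x0" using mn[OF x] \<open>\<not> \<phi> x \<le> w x\<close> by linarith
  with strict x0 have i: "x0 \<in> interior C" and p: "0 < pucci_max lam Lam (hessian \<phi> x0) + f x0" by auto
  have "\<forall>\<^sub>F z in nhds x0. z \<in> interior C" using i by (intro eventually_nhds_in_open) auto
  then have "local_min_at (\<lambda>x. w x - \<phi> x) x0"
    unfolding local_min_at_def using mn interior_subset[of C] by (auto elim!: eventually_mono)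
  then have "pucci_max lam Lam (hessian \<phi> x0) + f x0 \<le> 0"
    using vs x0 C(2) has_hessian_partials(1)[OF \<phi>] unfolding visc_supersol_def by blast
  with p show False by simp
qed

lemma hessian_add_const:
  assumes "has_hessian \<phi> H"
  shows "has_hessian (\<lambda>x. \<phi> x + c) H" "hessian (\<lambda>x. \<phi> x + c) x = hessian \<phi> x"
proof -
  show *: "has_hessian (\<lambda>x. \<phi> x + c) H" using has_hessian_add[OF assms has_hessian_const[of c]] by simp
  show "hessian (\<lambda>x. \<phi> x + c) x = hessian \<phi> x"
    using has_hessian_partials(2)[OF *] has_hessian_partials(2)[OF assms] by simp
qed

lemma polar_decomposition:
  fixes y :: "real^'n"
  obtains \<theta> where "norm \<theta> = 1" "y = norm y *\<^sub>R \<theta>"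
proof (cases "y = 0")
  case True
  obtain b :: "real^'n" where "b \<in> Basis" using nonempty_Basis by blast
  then show ?thesis using True that[of b] by simp
next
  case False
  then show ?thesis using that[of "y /\<^sub>R norm y"] by simp
qed

section \<open>The half-space setting and the linear operator in dimension nt\<close>

locale pucci_half_space =
  fixes k :: "'n::finite" and lam Lam nt :: real
  assumes lam_pos: "0 < lam" and lam_le: "lam \<le> Lam"
    and nt_eq: "Lam * nt = lam * (real CARD('n) - 1) + Lam"
    and nt_ge: "nt \<ge> 2"
begin

lemma Lam_pos: "0 < Lam" using lam_pos lam_le by linarith

abbreviation "S \<equiv> half_space k :: (real^'n) set"
abbreviation e :: "real^'n" where "e \<equiv> axis k 1"

lemma norm_e: "norm e = 1" by simp

lemma inner_e: "x \<bullet> e = x $ k" by (simp add: inner_axis)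

lemma open_S: "open S"
  unfolding half_space_def by (intro open_Collect_less continuous_intros)

lemma cball_subset_S: "r < x $ k \<Longrightarrow> cball x r \<subseteq> S"
proof
  fix y assume r: "r < x $ k" and y: "y \<in> cball x r"
  have "\<bar>(x - y) $ k\<bar> \<le> r" using y component_le_norm_cart[of "x - y" k] by (simp add: dist_norm)
  then show "y \<in> S" using r by (simp add: half_space_def)
qed

text \<open>One equation of the system, seen as a scalar inequality with a given nonnegative source,
  so that each estimate serves u and v alike.\<close>

definition is_supersol :: "(real^'n \<Rightarrow> real) \<Rightarrow> (real^'n \<Rightarrow> real) \<Rightarrow> bool" where
  "is_supersol w f \<longleftrightarrow> continuous_on S w \<and> (\<forall>x\<in>S. 0 \<le> w x \<and> 0 \<le> f x) \<and> visc_supersol lam Lam S w f"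

text \<open>For q constant this is Lam times the Laplacian of a radial function in dimension nt. The
  second derivative of q is the only term whose weight depends on the direction \<theta>.\<close>

lemma lin_op_radial:
  fixes y :: "real^'n"
  assumes "norm \<theta> = 1" "y = norm y *\<^sub>R \<theta>"
  shows "lin_op lam Lam \<theta> (prod_hess e q q' q'' g g' g'' y) =
     q'' (y $ k) * g (y \<bullet> y) * (lam + (Lam - lam) * (\<theta> $ k)\<^sup>2)
     + 2 * Lam * (2 * q' (y $ k) * (y $ k) + nt * q (y $ k)) * g' (y \<bullet> y)
     + 4 * Lam * q (y $ k) * g'' (y \<bullet> y) * (y \<bullet> y)"
  unfolding lin_op_prod_hess[OF norm_e assms] nt_eq[symmetric] inner_e by (simp add: algebra_simps)

text \<open>The barrier is a Gaussian shifted to vanish on the sphere of radius r1. The operator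
  applied to it has the sign of \<open>2 * \<gamma> * d\<^sup>2 - nt\<close> at distance d: positive
  beyond r0 by the choice of \<gamma>, while inside r0 the amplitude is such that the deficit is at
  most m / 2, half of the available source.\<close>

lemma ball_lower_bound:
  assumes w: "is_supersol w f" and B: "cball x1 r1 \<subseteq> S" and r0: "0 < r0" and m: "0 < m"
    and fm: "\<And>x. x \<in> cball x1 r0 \<Longrightarrow> x \<in> S \<Longrightarrow> m \<le> f x"
    and \<gamma>: "0 < \<gamma>" "nt < 2 * \<gamma> * r0\<^sup>2" and x: "x \<in> cball x1 r1"
  shows "m / (4 * Lam * \<gamma> * nt) * (exp (- \<gamma> * (dist x1 x)\<^sup>2) - exp (- \<gamma> * r1\<^sup>2)) \<le> w x"
proof -
  define A where "A = m / (4 * Lam * \<gamma> * nt)"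
  have A: "A > 0" using m \<gamma> nt_ge Lam_pos by (simp add: A_def)
  have Am: "2 * Lam * \<gamma> * nt * A = m / 2" using m \<gamma> nt_ge Lam_pos by (simp add: A_def field_simps)
  let ?g = "\<lambda>s. exp (- \<gamma> * s)"
  let ?H = "\<lambda>x. prod_hess e (\<lambda>t. 1) (\<lambda>t. 0) (\<lambda>t. 0) ?g (\<lambda>s. - \<gamma> * ?g s) (\<lambda>s. \<gamma>\<^sup>2 * ?g s) (x - x1)"
  have "has_hessian (\<lambda>x. 1 * ?g ((x - x1) \<bullet> (x - x1))) ?H"
    by (rule has_hessian_prod)
       (auto intro!: derivative_eq_intros continuous_intros simp: power2_eq_square)
  then have h: "has_hessian (\<lambda>x. A * ?g ((x - x1) \<bullet> (x - x1))) (\<lambda>x. A *\<^sub>R ?H x)"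
    using has_hessian_cmult by force
  define \<phi> where "\<phi> x = A * ?g ((x - x1) \<bullet> (x - x1)) + - A * exp (- \<gamma> * r1\<^sup>2)" for x
  have \<phi>: "has_hessian \<phi> (\<lambda>x. A *\<^sub>R ?H x)"
    unfolding \<phi>_def[abs_def] by (rule hessian_add_const[OF h])
  have d: "(x - x1) \<bullet> (x - x1) = (dist x1 x)\<^sup>2" for x
    by (metis dist_commute dist_norm power2_norm_eq_inner)
  have "\<phi> x \<le> w x"
  proof (rule visc_comparison[OF _ _ _ B \<phi> _ x])
    show "visc_supersol lam Lam S w f" "continuous_on S w" using w by (auto simp: is_supersol_def)
    fix z assume z: "z \<in> cball x1 r1" and gt: "w z < \<phi> z"
    have zS: "z \<in> S" using z B by auto
    have "0 < \<phi> z" using gt w zS unfolding is_supersol_def by force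
    then have "dist x1 z \<noteq> r1" by (auto simp: \<phi>_def d)
    then have int: "z \<in> interior (cball x1 r1)" using z by simp
    obtain \<theta> where th: "norm \<theta> = 1" "z - x1 = norm (z - x1) *\<^sub>R \<theta>" by (rule polar_decomposition)
    define E where "E = ?g ((dist x1 z)\<^sup>2)"
    have E: "0 < E" "E \<le> 1" using \<gamma> by (auto simp: E_def)
    have "lin_op lam Lam \<theta> (A *\<^sub>R ?H z) = A * (2 * Lam * \<gamma> * E * (2 * \<gamma> * (dist x1 z)\<^sup>2 - nt))"
      unfolding lin_op_scaleR lin_op_radial[OF th] d E_def by (simp add: algebra_simps power2_eq_square)
    also have "\<dots> + f z > 0"
    proof (cases "z \<in> cball x1 r0")
      case True
      have "A * (2 * Lam * \<gamma> * E * (2 * \<gamma> * (dist x1 z)\<^sup>2 - nt)) \<ge> A * (2 * Lam * \<gamma> * E * (- nt))"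
        using A Lam_pos \<gamma> E by (intro mult_left_mono) auto
      moreover have "A * (2 * Lam * \<gamma> * E * nt) \<le> A * (2 * Lam * \<gamma> * 1 * nt)"
        using A Lam_pos \<gamma> E nt_ge by (intro mult_left_mono mult_right_mono) auto
      moreover have "m \<le> f z" using fm True zS by auto
      ultimately show ?thesis using Am m by (simp add: algebra_simps)
    next
      case False
      then have "r0\<^sup>2 \<le> (dist x1 z)\<^sup>2" using r0 by (intro power_mono) auto
      then have "2 * \<gamma> * r0\<^sup>2 \<le> 2 * \<gamma> * (dist x1 z)\<^sup>2" using \<gamma> by simp
      then have "2 * \<gamma> * (dist x1 z)\<^sup>2 - nt > 0" using \<gamma> by linarith
      then have "A * (2 * Lam * \<gamma> * E * (2 * \<gamma> * (dist x1 z)\<^sup>2 - nt)) > 0"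
        using A Lam_pos \<gamma> E by simp
      moreover have "f z \<ge> 0" using w zS by (auto simp: is_supersol_def)
      ultimately show ?thesis by linarith
    qed
    finally have "0 < lin_op lam Lam \<theta> (A *\<^sub>R ?H z) + f z" .
    with lin_op_le_pucci_max_hessian[OF \<phi> lam_pos lam_le th(1), of z] int
    show "z \<in> interior (cball x1 r1) \<and> 0 < pucci_max lam Lam (hessian \<phi> z) + f z" by linarith
  qed simp
  then show ?thesis unfolding \<phi>_def d A_def[symmetric] by (simp add: right_diff_distrib)
qed

text \<open>The barrier of \<open>ball_lower_bound\<close> at distance R / 2, divided by
  \<open>R\<^sup>2 * m\<close>, for \<open>r1 = 9/10 * R\<close> and
  \<open>\<gamma> = 3 * nt / R\<^sup>2\<close>. Scaling \<gamma> this way makes it independent of R;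
  with r0 = R / 2 the condition on \<gamma> becomes nt < 3 nt / 2.\<close>

definition "ball_const = (exp (- 3 * nt / 4) - exp (- 3 * nt * (81/100))) / (12 * Lam * nt\<^sup>2)"

lemma ball_const_pos: "0 < ball_const"
  unfolding ball_const_def using Lam_pos nt_ge by (intro divide_pos_pos) auto

lemma cball_cone_subset: "0 < R \<Longrightarrow> cball (R *\<^sub>R e) (9/10 * R) \<subseteq> S"
  by (intro cball_subset_S) simp

lemma scaled_ball_lower_bound:
  assumes w: "is_supersol w f" and R: "0 < R" and m: "0 < m"
    and fm: "\<And>x. x \<in> cball (R *\<^sub>R e) (R / 2) \<Longrightarrow> m \<le> f x"
    and x: "x \<in> cball (R *\<^sub>R e) (R / 2)"
  shows "ball_const * R\<^sup>2 * m \<le> w x"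
proof -
  define \<gamma> where "\<gamma> = 3 * nt / R\<^sup>2"
  have g: "0 < \<gamma>" and gR: "\<gamma> * R\<^sup>2 = 3 * nt" using R nt_ge by (auto simp: \<gamma>_def)
  have "m / (4 * Lam * \<gamma> * nt) * (exp (- \<gamma> * (dist (R *\<^sub>R e) x)\<^sup>2) - exp (- \<gamma> * (9/10 * R)\<^sup>2)) \<le> w x"
  proof (rule ball_lower_bound[OF w cball_cone_subset[OF R] _ m _ g])
    show "nt < 2 * \<gamma> * (R / 2)\<^sup>2" using gR nt_ge by (simp add: power_divide)
    show "x \<in> cball (R *\<^sub>R e) (9/10 * R)" using x R by simp
  qed (use R fm in auto)
  moreover have "m / (4 * Lam * \<gamma> * nt) * (exp (- 3 * nt / 4) - exp (- 3 * nt * (81/100)))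
     \<le> m / (4 * Lam * \<gamma> * nt) * (exp (- \<gamma> * (dist (R *\<^sub>R e) x)\<^sup>2) - exp (- \<gamma> * (9/10 * R)\<^sup>2))"
  proof (rule mult_left_mono)
    have "(dist (R *\<^sub>R e) x)\<^sup>2 \<le> (R/2)\<^sup>2" using x by (intro power_mono) auto
    then have "\<gamma> * (dist (R *\<^sub>R e) x)\<^sup>2 \<le> \<gamma> * (R/2)\<^sup>2" using g by simp
    also have "\<dots> = 3 * nt / 4" using gR by (simp add: power_divide)
    finally have "exp (- 3 * nt / 4) \<le> exp (- \<gamma> * (dist (R *\<^sub>R e) x)\<^sup>2)" by simp
    moreover have e1: "- \<gamma> * (9/10 * R)\<^sup>2 = - 3 * nt * (81/100)"
      using arg_cong[OF gR, of "\<lambda>z. - (81/100) * z"] by (simp add: power_mult_distrib power_divide)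
    ultimately show "exp (- 3 * nt / 4) - exp (- 3 * nt * (81/100)) \<le> exp (- \<gamma> * (dist (R *\<^sub>R e) x)\<^sup>2) - exp (- \<gamma> * (9/10 * R)\<^sup>2)"
      unfolding e1 by (intro diff_right_mono)
  qed (use m g Lam_pos nt_ge in auto)
  moreover have "m / (4 * Lam * \<gamma> * nt) * (exp (- 3 * nt / 4) - exp (- 3 * nt * (81/100))) = ball_const * R\<^sup>2 * m"
    using R nt_ge Lam_pos by (simp add: ball_const_def \<gamma>_def power2_eq_square mult_ac)
  ultimately show ?thesis by linarith
qed

text \<open>A strong maximum principle across the system: positivity of z at the centre alone gives
  a source near the centre, and the Gaussian barrier carries it to the whole ball touching the
  boundary.\<close>

lemma positive_on_ball:
  assumes w: "is_supersol w (\<lambda>x. z x powr p)" and z: "continuous_on S z" and p: "p > 0"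
    and x1: "x1 \<in> S" "0 < z x1" and x: "dist x1 x < x1 $ k"
  shows "0 < w x"
proof -
  obtain r1 where r1: "dist x1 x < r1" "r1 < x1 $ k" using x dense by blast
  have r1p: "0 < r1" using r1 zero_le_dist[of x1 x] by linarith
  obtain d where d: "d > 0" "\<And>y. y \<in> S \<Longrightarrow> dist y x1 < d \<Longrightarrow> dist (z y) (z x1) < z x1 / 2"
    using z x1 unfolding continuous_on_iff by (meson half_gt_zero)
  define r0 where "r0 = d / 2"
  have r0: "0 < r0" using d by (simp add: r0_def)
  define m where "m = (z x1 / 2) powr p"
  have m: "0 < m" using x1 by (simp add: m_def)
  \<comment> \<open>Then \<open>2 * \<gamma> * r0\<^sup>2 = 2 * nt\<close>, above the required
    nt.\<close>
  define \<gamma> where "\<gamma> = nt / r0\<^sup>2"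
  have g: "0 < \<gamma>" using nt_ge r0 by (simp add: \<gamma>_def)
  have fm: "m \<le> z y powr p" if "y \<in> cball x1 r0" "y \<in> S" for y
  proof -
    have "dist y x1 < d" using that d by (simp add: dist_commute r0_def)
    then have "z y \<ge> z x1 / 2" using d(2)[OF that(2)] by (simp add: dist_real_def abs_if split: if_splits)
    then show ?thesis unfolding m_def using x1 p by (intro powr_mono2) auto
  qed
  have "m / (4 * Lam * \<gamma> * nt) * (exp (- \<gamma> * (dist x1 x)\<^sup>2) - exp (- \<gamma> * r1\<^sup>2)) \<le> w x"
    by (rule ball_lower_bound[OF w cball_subset_S[OF r1(2)] r0 m fm g])
       (use r1 g r0 nt_ge in \<open>auto simp: \<gamma>_def\<close>)
  moreover have "(dist x1 x)\<^sup>2 < r1\<^sup>2" using r1 by (intro power_strict_mono) auto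
  then have "exp (- \<gamma> * (dist x1 x)\<^sup>2) - exp (- \<gamma> * r1\<^sup>2) > 0" using g by simp
  then have "m / (4 * Lam * \<gamma> * nt) * (exp (- \<gamma> * (dist x1 x)\<^sup>2) - exp (- \<gamma> * r1\<^sup>2)) > 0"
    using m Lam_pos g nt_ge by simp
  ultimately show ?thesis by linarith
qed

text \<open>The constant \<open>0\<close> is an admissible test function at a zero of a nonnegative function.\<close>

lemma source_zero_at_zero:
  assumes w: "is_supersol w f" and x: "x \<in> S" "w x = 0"
  shows "f x = 0"
proof -
  have h: "has_hessian (\<lambda>x::real^'n. 0) (\<lambda>x. 0)" by (rule has_hessian_const)
  have "\<forall>\<^sub>F z in nhds x. z \<in> S" using open_S x by (intro eventually_nhds_in_open) auto
  then have "local_min_at (\<lambda>x. w x - 0) x"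
    unfolding local_min_at_def using w x by (auto elim!: eventually_mono simp: is_supersol_def)
  then have "pucci_max lam Lam (hessian (\<lambda>x. 0) x) + f x \<le> 0"
    using w x has_hessian_partials(1)[OF h] unfolding is_supersol_def visc_supersol_def by blast
  moreover have "lin_op lam Lam e 0 \<le> pucci_max lam Lam (hessian (\<lambda>x. 0) x)"
    by (rule lin_op_le_pucci_max_hessian[OF h lam_pos lam_le norm_e])
  moreover have "lin_op lam Lam e 0 = 0" using lin_op_scaleR[of lam Lam e 0 0] by simp
  moreover have "f x \<ge> 0" using w x by (auto simp: is_supersol_def)
  ultimately show ?thesis by linarith
qed

lemma both_positive:
  assumes u: "is_supersol u (\<lambda>x. v x powr p)" and v: "is_supersol v (\<lambda>x. u x powr q)"
    and pq: "p > 0" "q > 0" and x1: "x1 \<in> S" "u x1 \<noteq> 0 \<or> v x1 \<noteq> 0" and x: "x \<in> S"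
  shows "0 < u x \<and> 0 < v x"
proof -
  have nn: "0 \<le> u x" "0 \<le> v x" if "x \<in> S" for x using u v that by (auto simp: is_supersol_def)
  have iff: "u x = 0 \<longleftrightarrow> v x = 0" if "x \<in> S" for x
    using source_zero_at_zero[OF u that] source_zero_at_zero[OF v that] by auto
  have "connected S"
    using convex_connected[OF convex_halfspace_gt[of 0 e]]
    by (simp add: half_space_def inner_e inner_commute[of e])
  have "0 < u x"
  proof (rule connected_induction_simple[OF \<open>connected S\<close> x1(1) x, where P = "\<lambda>x. 0 < u x"])
    show "0 < u x1" using x1 iff nn by (metis order_le_less)
    fix a assume a: "a \<in> S"
    \<comment> \<open>Two points of this ball are less than \<open>2/3 * a $ k\<close> apart, while
      each has height above \<open>2/3 * a $ k\<close>; hence each lies in the ball about the other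
      to which \<open>positive_on_ball\<close> applies.\<close>
    let ?T = "ball a (a $ k / 3)"
    have ak: "0 < a $ k" using a by (simp add: half_space_def)
    then have TS: "?T \<subseteq> S" using cball_subset_S[of "a $ k / 3" a] by (auto simp: subset_iff)
    have "0 < u y" if "x \<in> ?T" "y \<in> ?T" "0 < u x" for x y
    proof -
      have xS: "x \<in> S" and yS: "y \<in> S" using TS that by auto
      have "\<bar>(a - x) $ k\<bar> < a $ k / 3"
        using that(1) component_le_norm_cart[of "a - x" k] by (simp add: dist_norm)
      then have "x $ k > 2 / 3 * a $ k" by (simp add: abs_if split: if_splits)
      moreover have "dist x y < a $ k / 3 + a $ k / 3"
        using that by (intro dist_triangle_less_add[of _ a]) (auto simp: dist_commute)
      ultimately have "dist x y < x $ k" by linarith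
      moreover have "continuous_on S u" using u by (simp add: is_supersol_def)
      ultimately have "0 < v y" using positive_on_ball[OF v _ pq(2) xS that(3)] by blast
      then show ?thesis using iff[OF yS] nn[OF yS] by (metis less_irrefl order_le_less)
    qed
    moreover have "a \<in> ?T" using ak by simp
    ultimately show "\<exists>T. openin (top_of_set S) T \<and> a \<in> T \<and> (\<forall>x\<in>T. \<forall>y\<in>T. 0 < u x \<longrightarrow> 0 < u y)"
      using open_subset[OF TS open_ball] by blast
  qed
  then show ?thesis using iff[OF x] nn[OF x] by (metis less_irrefl order_le_less)
qed

text \<open>Lowering the barrier by \<eta> makes it nonpositive far out, which confines a possible
  violation to a bounded half-annulus. Comparison there and \<eta> tending to 0 give the claim; on
  the flat part only w \<ge> 0 is available, whence \<open>flat\<close>.\<close>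

lemma exterior_comparison:
  assumes w: "is_supersol w f" and \<phi>: "has_hessian \<phi> H" and \<rho>0: "0 < \<rho>0"
    and flat: "\<And>x. \<rho>0 \<le> norm (x - e) \<Longrightarrow> (x - e) $ k = 0 \<Longrightarrow> \<phi> x \<le> 0"
    and inner: "\<And>x. norm (x - e) = \<rho>0 \<Longrightarrow> 0 \<le> (x - e) $ k \<Longrightarrow> \<phi> x \<le> w x"
    and decay: "\<And>\<eta>. 0 < \<eta> \<Longrightarrow> \<exists>\<rho>. \<forall>x. \<rho> \<le> norm (x - e) \<longrightarrow> 0 \<le> (x - e) $ k \<longrightarrow> \<phi> x \<le> \<eta>"
    and sub: "\<And>x. \<rho>0 < norm (x - e) \<Longrightarrow> 0 < (x - e) $ k \<Longrightarrow> 0 < pucci_max lam Lam (hessian \<phi> x) + f x"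
    and x: "\<rho>0 \<le> norm (x - e)" "0 \<le> (x - e) $ k"
  shows "\<phi> x \<le> w x"
proof -
  have "\<phi> x \<le> w x + \<eta>" if \<eta>: "0 < \<eta>" for \<eta>
  proof -
    obtain \<rho> where \<rho>: "\<And>x. \<rho> \<le> norm (x - e) \<Longrightarrow> 0 \<le> (x - e) $ k \<Longrightarrow> \<phi> x \<le> \<eta>" using decay[OF \<eta>] by blast
    \<comment> \<open>Large enough both to contain the given x and to put the outer sphere where the
      barrier is at most \<eta>.\<close>
    define r where "r = max \<rho> (norm (x - e)) + 1"
    define C where "C = cball e r \<inter> ({x. \<rho>0 \<le> norm (x - e)} \<inter> {x. 0 \<le> (x - e) $ k})"
    define D where "D = ball e r \<inter> ({x. \<rho>0 < norm (x - e)} \<inter> {x. 0 < (x - e) $ k})"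
    have "closed ({x. \<rho>0 \<le> norm (x - e)} \<inter> {x. 0 \<le> (x - e) $ k})"
      by (intro closed_Int closed_Collect_le continuous_intros)
    then have C: "compact C" unfolding C_def by (intro compact_Int_closed compact_cball)
    have "open D" unfolding D_def by (intro open_Int open_Collect_less continuous_intros open_ball)
    moreover have "D \<subseteq> C" by (auto simp: D_def C_def)
    ultimately have DC: "D \<subseteq> interior C" by (rule interior_maximal[rotated])
    have CS: "C \<subseteq> S" by (auto simp: C_def half_space_def)
    have h: "has_hessian (\<lambda>x. \<phi> x + - \<eta>) H" by (rule hessian_add_const[OF \<phi>])
    have "\<phi> x + - \<eta> \<le> w x"
    proof (rule visc_comparison[OF _ _ C CS h])
      show "visc_supersol lam Lam S w f" "continuous_on S w" using w by (auto simp: is_supersol_def)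
      show "x \<in> C" using x by (auto simp: C_def r_def dist_norm norm_minus_commute)
      fix z assume z: "z \<in> C" and gt: "w z < \<phi> z + - \<eta>"
      have w0: "0 \<le> w z" using w z CS by (auto simp: is_supersol_def)
      have z': "dist e z \<le> r" "\<rho>0 \<le> norm (z - e)" "0 \<le> (z - e) $ k" using z unfolding C_def by auto
      have "norm (z - e) < \<rho>" using \<rho>[of z] z'(3) gt w0 by linarith
      then have "dist e z < r" by (simp add: r_def dist_norm norm_minus_commute)
      moreover have "norm (z - e) \<noteq> \<rho>0" using inner[of z] z'(3) gt \<eta> by auto
      moreover have "(z - e) $ k \<noteq> 0" using flat[of z] z'(2) gt w0 \<eta> by auto
      ultimately have zD: "z \<in> D" using z' by (auto simp: D_def simp del: vector_minus_component)
      then have "0 < pucci_max lam Lam (hessian \<phi> z) + f z" using sub unfolding D_def by auto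
      then show "z \<in> interior C \<and> 0 < pucci_max lam Lam (hessian (\<lambda>x. \<phi> x + - \<eta>) z) + f z"
        unfolding hessian_add_const(2)[OF \<phi>] using zD DC by auto
    qed
    then show ?thesis by simp
  qed
  then show ?thesis by (rule field_le_epsilon)
qed

end

subsection \<open>Lower bounds by homogeneous barriers\<close>

lemma DERIV_shifted_powr:
  fixes a s :: real
  assumes "s \<ge> 0" "d = a * (1 + s) powr (a - 1)"
  shows "((\<lambda>s. (1 + s) powr a) has_real_derivative d) (at s)"
  using assms by (auto intro!: derivative_eq_intros)

lemma continuous_on_shifted_powr: "continuous_on {0..} (\<lambda>s::real. (1 + s) powr a)"
  by (intro continuous_intros) auto

text \<open>The expression is (2 b + 2) g' + 2 s g'' for g the sum of the powers -b and -b - 1/2 of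
  1 + s. With \<tau> the square root of 1 + s, it is a positive factor times a quadratic in \<tau>:
  the power -b would give 0 with s in place of 1 + s and leaves a negative linear term, and the
  faster power supplies the leading coefficient b + 1/2. The bound \<tau> \<ge> 4 b + 8 makes the
  quadratic positive.\<close>

lemma barrier_coefficient_pos:
  fixes b s :: real
  assumes b: "b \<ge> 1" and s: "(4 * b + 8)\<^sup>2 \<le> 1 + s"
  shows "0 < (2 * b + 2) * (- b * (1 + s) powr (- b - 1) + - (b + 1/2) * (1 + s) powr (- b - 3/2))
     + 2 * s * (b * (b + 1) * (1 + s) powr (- b - 2) + (b + 1/2) * (b + 3/2) * (1 + s) powr (- b - 5/2))"
proof -
  define \<tau> where "\<tau> = (1 + s) powr (1/2)"
  define P where "P = (1 + s) powr (- b - 5/2)"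
  have s1: "1 + s > 0" using s b by (smt (verit) zero_less_power)
  have P: "P > 0" using s1 by (simp add: P_def)
  have tt: "\<tau> * \<tau> = 1 + s" using s1 unfolding \<tau>_def powr_add[symmetric] by simp
  have e1: "(1 + s) powr (- b - 2) = P * \<tau>"
    unfolding P_def \<tau>_def powr_add[symmetric] by (rule arg_cong[where f = "(powr) (1 + s)"]) simp
  have e2: "(1 + s) powr (- b - 3/2) = P * \<tau> * \<tau>"
    unfolding P_def \<tau>_def powr_add[symmetric] by (rule arg_cong[where f = "(powr) (1 + s)"]) simp
  have e3: "(1 + s) powr (- b - 1) = P * \<tau> * \<tau> * \<tau>"
    unfolding P_def \<tau>_def powr_add[symmetric] by (rule arg_cong[where f = "(powr) (1 + s)"]) simp
  have s_eq: "s = \<tau> * \<tau> - 1" using tt by simp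
  have "(4 * b + 8)\<^sup>2 \<le> \<tau>\<^sup>2" using s tt by (simp add: power2_eq_square)
  then have \<tau>: "4 * b + 8 \<le> \<tau>" by (rule power2_le_imp_le) (simp add: \<tau>_def)
  have "(b + 1/2) * (4 * b + 8) * \<tau> \<le> (b + 1/2) * \<tau> * \<tau>"
    using \<tau> b by (intro mult_right_mono mult_left_mono) auto
  moreover have "(2 * b\<^sup>2 + 8 * b + 4) * 1 \<le> (2 * b\<^sup>2 + 8 * b + 4) * \<tau>"
    using \<tau> b by (intro mult_left_mono) auto
  moreover have "2 * b * (b + 1) * \<tau> + 2 * (b + 1/2) * (b + 3/2)
      = (b + 1/2) * (4 * b + 8) * \<tau> - (2 * b\<^sup>2 + 8 * b + 4) * \<tau> + (2 * b\<^sup>2 + 8 * b + 4) * 1 - (4 * b + 5/2)"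
    by (simp add: field_simps power2_eq_square)
  ultimately have "0 < (b + 1/2) * \<tau> * \<tau> - 2 * b * (b + 1) * \<tau> - 2 * (b + 1/2) * (b + 3/2)"
    using b by linarith
  with P have "0 < P * ((b + 1/2) * \<tau> * \<tau> - 2 * b * (b + 1) * \<tau> - 2 * (b + 1/2) * (b + 3/2))" by simp
  also have "\<dots> = (2 * b + 2) * (- b * (1 + s) powr (- b - 1) + - (b + 1/2) * (1 + s) powr (- b - 3/2))
     + 2 * s * (b * (b + 1) * (1 + s) powr (- b - 2) + (b + 1/2) * (b + 3/2) * (1 + s) powr (- b - 5/2))"
    unfolding e1 e2 e3 P_def[symmetric] unfolding s_eq by (simp add: field_simps)
  finally show ?thesis .
qed

text \<open>The same expression for g = (1 + s)^(-b) ln (1 + s). The terms in (1 + s) ln (1 + s)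
  cancel; the logarithm left over from s = (1 + s) - 1 is absorbed by ln (1 + s) \<le> 1 +
  s.\<close>

lemma log_barrier_coefficient_ge:
  fixes b s :: real
  assumes b: "b \<ge> 1" and s: "0 \<le> s"
  shows "- 2 * b * (b + 2) * (1 + s) powr (- b - 1)
    \<le> (2 * b + 2) * ((1 + s) powr (- b - 1) * (1 - b * ln (1 + s)))
     + 2 * s * ((1 + s) powr (- b - 2) * (b * (b + 1) * ln (1 + s) - (2 * b + 1)))"
proof -
  define V where "V = (1 + s) powr (- b - 2)"
  define L where "L = ln (1 + s)"
  have V: "V > 0" using s by (simp add: V_def)
  have e: "(1 + s) powr (- b - 1) = (1 + s) * V"
  proof -
    have "(1 + s) * V = (1 + s) powr 1 * (1 + s) powr (- b - 2)" using s by (simp add: V_def)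
    also have "\<dots> = (1 + s) powr (- b - 1)" unfolding powr_add[symmetric] by (rule arg_cong[where f = "(powr) (1 + s)"]) simp
    finally show ?thesis by simp
  qed
  have "L \<le> 1 + s" using ln_le_minus_one[of "1 + s"] s by (simp add: L_def)
  then have "2 * b * (b + 1) * V * L \<le> 2 * b * (b + 1) * V * (1 + s)"
    using V b by (intro mult_left_mono) auto
  moreover have "2 * V * (2 * b + 1) \<ge> 0" using V b by simp
  ultimately show ?thesis
    unfolding e V_def[symmetric] L_def[symmetric] by (simp add: algebra_simps)
qed

text \<open>Supplies \<open>decay\<close> in \<open>exterior_comparison\<close>: both barriers are
  bounded by a multiple of this power since b \<ge> 1, and the radius is explicit because (1 +
  |y|^2)^(1/4) is at least the square root of |y|.\<close>

lemma quarter_power_decay: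
  fixes K \<eta> :: real and y :: "real^'n"
  assumes K: "0 < K" and \<eta>: "0 < \<eta>" and y: "(K / \<eta>)\<^sup>2 \<le> norm y"
  shows "K * (1 + y \<bullet> y) powr (- 1/4) \<le> \<eta>"
proof -
  have "((K / \<eta>)\<^sup>2)\<^sup>2 \<le> (norm y)\<^sup>2" using y by (intro power_mono) auto
  then have "(K / \<eta>) ^ 4 \<le> 1 + y \<bullet> y"
    by (simp add: power2_norm_eq_inner flip: power_mult)
  also have "\<dots> = ((1 + y \<bullet> y) powr (1/4)) ^ 4"
    by (subst powr_power) (auto simp: add_nonneg_eq_0_iff)
  finally have "K / \<eta> \<le> (1 + y \<bullet> y) powr (1/4)"
    using K \<eta> by (subst (asm) power_mono_iff) auto
  then have "K \<le> \<eta> * (1 + y \<bullet> y) powr (1/4)" using \<eta> by (simp add: field_simps)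
  moreover have "1 + y \<bullet> y > 0" by (simp add: add_pos_nonneg)
  ultimately show ?thesis by (simp add: powr_minus field_simps)
qed

lemma component_le_half_power:
  fixes y :: "real^'n"
  shows "y $ k \<le> (1 + y \<bullet> y) powr (1/2)"
proof -
  have "y $ k \<le> norm y" using component_le_norm_cart[of y k] by linarith
  also have "\<dots> \<le> sqrt (1 + y \<bullet> y)" by (simp add: norm_eq_sqrt_inner)
  also have "\<dots> = (1 + y \<bullet> y) powr (1/2)" by (simp add: powr_half_sqrt)
  finally show ?thesis .
qed

context pucci_half_space
begin

text \<open>In the variable s = |y|^2 the factor |y|^(-nt) becomes s^(-b). The radius
  \<open>\<rho>0\<close> equals 4 b + 8, the threshold of
  \<open>barrier_coefficient_pos\<close>.\<close>

definition "b = nt / 2"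
definition "\<rho>0 = 2 * nt + 8"

lemma b_ge: "b \<ge> 1" using nt_ge by (simp add: b_def)

lemma \<rho>0_pos: "0 < \<rho>0" using nt_ge by (simp add: \<rho>0_def)

lemma inner_e': "(x - e) \<bullet> e = (x - e) $ k" by (rule inner_e)

lemma lin_op_linear_times_radial:
  fixes y :: "real^'n"
  assumes "norm \<theta> = 1" "y = norm y *\<^sub>R \<theta>"
  shows "lin_op lam Lam \<theta> (prod_hess e (\<lambda>t. t) (\<lambda>t. 1) (\<lambda>t. 0) g g' g'' y) =
     2 * Lam * y $ k * ((2 * b + 2) * g' (y \<bullet> y) + 2 * (y \<bullet> y) * g'' (y \<bullet> y))"
  unfolding lin_op_radial[OF assms] b_def by (simp add: algebra_simps)

lemma lin_op_square_times_radial: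
  fixes y :: "real^'n"
  assumes "norm \<theta> = 1" "y = norm y *\<^sub>R \<theta>"
  shows "lin_op lam Lam \<theta> (prod_hess e (\<lambda>t. t\<^sup>2) (\<lambda>t. 2 * t) (\<lambda>t. 2) g g' g'' y) =
     2 * g (y \<bullet> y) * (lam + (Lam - lam) * (\<theta> $ k)\<^sup>2)
     + 2 * Lam * (4 + 2 * b) * (y $ k)\<^sup>2 * g' (y \<bullet> y) + 4 * Lam * (y $ k)\<^sup>2 * g'' (y \<bullet> y) * (y \<bullet> y)"
  unfolding lin_op_radial[OF assms] b_def by (simp add: algebra_simps power2_eq_square)

text \<open>
  Since nothing is known at the boundary, the barriers are centred at \<open>e\<close> and live in \<open>x\<^sub>n > 1\<close>, where
  \<open>w\<close> is bounded below on compact sets. Replacing \<open>|x - e|\<^sup>2\<close> by \<open>1 + |x - e|\<^sup>2\<close> removes the singularity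
  at \<open>e\<close>, as test functions must be \<open>C\<^sup>2\<close> on the whole half-space; the resulting negative error is
  absorbed by the term with exponent \<open>- b - 1/2\<close>.
\<close>

lemma exterior_lower_bound:
  assumes w: "is_supersol w f" and pos: "\<And>x. x \<in> S \<Longrightarrow> 0 < w x"
  shows "\<exists>c>0. \<forall>x. \<rho>0 \<le> norm (x - e) \<longrightarrow> 0 \<le> (x - e) $ k \<longrightarrow>
           c * (x - e) $ k * (1 + (x - e) \<bullet> (x - e)) powr (- b) \<le> w x"
proof -
  define K where "K = sphere e \<rho>0 \<inter> {x. 0 \<le> (x - e) $ k}"
  have K: "compact K" unfolding K_def
    by (intro compact_Int_closed compact_sphere closed_Collect_le continuous_intros)
  have KS: "K \<subseteq> S" by (auto simp: K_def half_space_def)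
  have "continuous_on K w" using w KS continuous_on_subset by (auto simp: is_supersol_def)
  have "\<exists>\<delta>>0. \<forall>x\<in>K. \<delta> \<le> w x"
  proof (cases "K = {}")
    case False
    with continuous_attains_inf[OF K _ \<open>continuous_on K w\<close>] obtain x0 where "x0 \<in> K" "\<forall>x\<in>K. w x0 \<le> w x" by blast
    then show ?thesis using pos KS by blast
  qed (auto intro: exI[of _ 1])
  then obtain \<delta> where \<delta>: "0 < \<delta>" "\<And>x. x \<in> K \<Longrightarrow> \<delta> \<le> w x" by blast
  \<comment> \<open>On the inner sphere the height above e is at most \<open>\<rho>0\<close> and the
    radial factor at most 2, so this amplitude keeps the barrier below \<delta>.\<close>
  define \<epsilon> where "\<epsilon> = \<delta> / (2 * \<rho>0)"
  have \<epsilon>: "0 < \<epsilon>" using \<delta> \<rho>0_pos by (simp add: \<epsilon>_def)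
  let ?g = "\<lambda>s::real. (1 + s) powr (- b) + (1 + s) powr (- b - 1/2)"
  let ?g' = "\<lambda>s::real. - b * (1 + s) powr (- b - 1) + - (b + 1/2) * (1 + s) powr (- b - 3/2)"
  let ?g'' = "\<lambda>s::real. b * (b + 1) * (1 + s) powr (- b - 2) + (b + 1/2) * (b + 3/2) * (1 + s) powr (- b - 5/2)"
  let ?H = "\<lambda>x. prod_hess e (\<lambda>t. t) (\<lambda>t. 1) (\<lambda>t. 0) ?g ?g' ?g'' (x - e)"
  have "has_hessian (\<lambda>x. ((x - e) \<bullet> e) * ?g ((x - e) \<bullet> (x - e))) ?H"
  proof (rule has_hessian_prod)
    fix s :: real assume s: "0 \<le> s"
    show "(?g has_real_derivative ?g' s) (at s)"
      by (intro DERIV_add DERIV_shifted_powr s) (auto simp: algebra_simps)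
    have "(?g' has_real_derivative (- b * (- (b + 1) * (1 + s) powr (- b - 2)) + - (b + 1/2) * (- (b + 3/2) * (1 + s) powr (- b - 5/2)))) (at s)"
      by (intro DERIV_add DERIV_cmult DERIV_shifted_powr s) (auto simp: algebra_simps)
    then show "(?g' has_real_derivative ?g'' s) (at s)" by (rule DERIV_cong) (simp add: field_simps)
  next
    show "continuous_on {0..} ?g''"
      by (intro continuous_on_add continuous_on_mult continuous_on_const continuous_on_shifted_powr)
  qed auto
  then have h: "has_hessian (\<lambda>x. \<epsilon> * (((x - e) \<bullet> e) * ?g ((x - e) \<bullet> (x - e)))) (\<lambda>x. \<epsilon> *\<^sub>R ?H x)"
    by (rule has_hessian_cmult)
  define \<phi> where "\<phi> x = \<epsilon> * ((x - e) $ k * ?g ((x - e) \<bullet> (x - e)))" for x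
  have \<phi>: "has_hessian \<phi> (\<lambda>x. \<epsilon> *\<^sub>R ?H x)"
    using h unfolding \<phi>_def[abs_def] inner_e' .
  have \<sigma>1: "1 \<le> 1 + y \<bullet> y" for y :: "real^'n" by simp
  have g2: "?g (y \<bullet> y) \<le> 2 * (1 + y \<bullet> y) powr (- b)" for y :: "real^'n"
    using powr_mono[of "- b - 1/2" "- b" "1 + y \<bullet> y"] by simp
  have le: "\<phi> x \<le> w x" if "\<rho>0 \<le> norm (x - e)" "0 \<le> (x - e) $ k" for x
  proof (rule exterior_comparison[OF w \<phi> \<rho>0_pos _ _ _ _ that])
    fix x assume x: "(x - e) $ k = 0"
    show "\<phi> x \<le> 0" unfolding \<phi>_def x by simp
  next
    fix x assume x: "norm (x - e) = \<rho>0" "0 \<le> (x - e) $ k"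
    have "(x - e) $ k \<le> \<rho>0" using component_le_norm_cart[of "x - e" k] x by linarith
    moreover have "?g ((x - e) \<bullet> (x - e)) \<le> 2"
      using g2[of "x - e"] powr_mono[of "- b" 0 "1 + (x - e) \<bullet> (x - e)"] b_ge \<sigma>1[of "x - e"] by auto
    ultimately have "(x - e) $ k * ?g ((x - e) \<bullet> (x - e)) \<le> \<rho>0 * 2"
      using x(2) \<rho>0_pos by (intro mult_mono) auto
    then have "\<phi> x \<le> \<epsilon> * (\<rho>0 * 2)" using \<epsilon> unfolding \<phi>_def by simp
    also have "\<dots> = \<delta>" using \<rho>0_pos by (simp add: \<epsilon>_def)
    also have "\<dots> \<le> w x" using x \<delta>(2)[of x] by (simp add: K_def dist_norm norm_minus_commute)
    finally show "\<phi> x \<le> w x" .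
  next
    fix \<eta> :: real assume \<eta>: "0 < \<eta>"
    show "\<exists>\<rho>. \<forall>x. \<rho> \<le> norm (x - e) \<longrightarrow> 0 \<le> (x - e) $ k \<longrightarrow> \<phi> x \<le> \<eta>"
    proof (intro exI[of _ "(2 * \<epsilon> / \<eta>)\<^sup>2"] allI impI)
      fix x assume x: "(2 * \<epsilon> / \<eta>)\<^sup>2 \<le> norm (x - e)" "0 \<le> (x - e) $ k"
      let ?s = "1 + (x - e) \<bullet> (x - e)"
      have "(x - e) $ k * ?g ((x - e) \<bullet> (x - e)) \<le> ?s powr (1/2) * (2 * ?s powr (- b))"
        using component_le_half_power[of "x - e" k] g2[of "x - e"] x(2) by (intro mult_mono) auto
      also have "\<dots> = 2 * ?s powr (1/2 - b)" by (simp add: powr_add[symmetric])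
      also have "\<dots> \<le> 2 * ?s powr (- 1/4)"
        using powr_mono[of "1/2 - b" "- 1/4" ?s] b_ge \<sigma>1[of "x - e"] by auto
      finally have "\<phi> x \<le> 2 * \<epsilon> * ?s powr (- 1/4)" using \<epsilon> unfolding \<phi>_def by simp
      also have "\<dots> \<le> \<eta>" using quarter_power_decay[OF _ \<eta> x(1)] \<epsilon> by simp
      finally show "\<phi> x \<le> \<eta>" .
    qed
  next
    fix x assume x: "\<rho>0 < norm (x - e)" "0 < (x - e) $ k"
    obtain \<theta> where th: "norm \<theta> = 1" "x - e = norm (x - e) *\<^sub>R \<theta>" by (rule polar_decomposition)
    let ?s = "(x - e) \<bullet> (x - e)"
    have "\<rho>0\<^sup>2 \<le> (norm (x - e))\<^sup>2" using x \<rho>0_pos by (intro power_mono) auto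
    then have "(4 * b + 8)\<^sup>2 \<le> 1 + ?s" by (simp add: \<rho>0_def b_def power2_norm_eq_inner)
    note pos = barrier_coefficient_pos[OF b_ge this]
    have "lin_op lam Lam \<theta> (\<epsilon> *\<^sub>R ?H x) = \<epsilon> * (2 * Lam * (x - e) $ k * ((2 * b + 2) * ?g' ?s + 2 * ?s * ?g'' ?s))"
      unfolding lin_op_scaleR lin_op_linear_times_radial[OF th] ..
    also have "\<dots> > 0" using pos \<epsilon> x(2) Lam_pos by (intro mult_pos_pos) auto
    finally have "lin_op lam Lam \<theta> (\<epsilon> *\<^sub>R ?H x) > 0" .
    moreover have "x \<in> S" using x(2) by (simp add: half_space_def)
    then have "f x \<ge> 0" using w by (auto simp: is_supersol_def)
    ultimately show "0 < pucci_max lam Lam (hessian \<phi> x) + f x"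
      using lin_op_le_pucci_max_hessian[OF \<phi> lam_pos lam_le th(1), of x] by linarith
  qed
  show ?thesis
  proof (intro exI[of _ \<epsilon>] conjI \<epsilon> allI impI)
    fix x assume x: "\<rho>0 \<le> norm (x - e)" "0 \<le> (x - e) $ k"
    have "\<epsilon> * (x - e) $ k * (1 + (x - e) \<bullet> (x - e)) powr (- b) \<le> \<phi> x"
      unfolding \<phi>_def mult.assoc using \<epsilon> x(2) by (intro mult_left_mono) auto
    with le[OF x] show "\<epsilon> * (x - e) $ k * (1 + (x - e) \<bullet> (x - e)) powr (- b) \<le> w x" by linarith
  qed
qed

text \<open>
  The operator maps the logarithmic term to something negative of order \<open>t = x\<^sub>n - 1\<close> near \<open>t = 0\<close>, which the
  source, of order \<open>t^p\<close> with \<open>p > 1\<close>, cannot compensate there. The additional term, quadratic in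
  \<open>t\<close>, contributes \<open>2 lam\<close> times its radial factor and takes over in that region.
\<close>

lemma log_lower_bound:
  assumes w: "is_supersol w (\<lambda>x. z x powr p)" and p: "0 < p" "p * (nt - 1) = nt + 1" and c: "0 < c"
    and wc: "\<And>x. \<rho>0 \<le> norm (x - e) \<Longrightarrow> 0 \<le> (x - e) $ k \<Longrightarrow>
           c * (x - e) $ k * (1 + (x - e) \<bullet> (x - e)) powr (- b) \<le> w x"
    and zc: "\<And>x. \<rho>0 \<le> norm (x - e) \<Longrightarrow> 0 \<le> (x - e) $ k \<Longrightarrow>
           c * (x - e) $ k * (1 + (x - e) \<bullet> (x - e)) powr (- b) \<le> z x"
  shows "\<exists>\<epsilon>>0. \<forall>x. \<rho>0 \<le> norm (x - e) \<longrightarrow> 0 \<le> (x - e) $ k \<longrightarrow>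
           \<epsilon> * (x - e) $ k * (1 + (x - e) \<bullet> (x - e)) powr (- b) * ln (1 + (x - e) \<bullet> (x - e)) \<le> w x"
proof -
  \<comment> \<open>Sum of the coefficients of the negative contributions: the first summand from
    the logarithmic term, the second from the quadratic one.\<close>
  define C where "C = 4 * Lam * b * (b + 2) + 2 * Lam * (4 + 2 * b) * (b + 1/2)"
  have C: "0 < C" unfolding C_def using Lam_pos b_ge by (intro add_pos_pos mult_pos_pos) auto
  define c0 where "c0 = lam / C"
  have c0: "0 < c0" using lam_pos C by (simp add: c0_def)
  \<comment> \<open>The first bound lets the source beat C wherever the slope variable
    \<open>r\<close> introduced below exceeds \<open>c0\<close>; the second keeps the barrier below
    w on the inner sphere.\<close>
  define \<epsilon> where "\<epsilon> = min (c powr p * c0 powr p / (2 * C)) (c / (ln (1 + \<rho>0\<^sup>2) + 1))"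
  have lnp: "0 \<le> ln (1 + \<rho>0\<^sup>2)" by simp
  then have lnp1: "0 < ln (1 + \<rho>0\<^sup>2) + 1" by linarith
  have \<epsilon>: "0 < \<epsilon>" using c c0 C lnp1 by (simp add: \<epsilon>_def)
  have \<epsilon>1: "\<epsilon> * C < c powr p * c0 powr p"
  proof -
    have "\<epsilon> * C \<le> c powr p * c0 powr p / (2 * C) * C" using C by (intro mult_right_mono) (auto simp: \<epsilon>_def)
    also have "\<dots> < c powr p * c0 powr p" using C c c0 by simp
    finally show ?thesis .
  qed
  have \<epsilon>2: "\<epsilon> * (ln (1 + \<rho>0\<^sup>2) + 1) \<le> c"
  proof -
    have "\<epsilon> * (ln (1 + \<rho>0\<^sup>2) + 1) \<le> c / (ln (1 + \<rho>0\<^sup>2) + 1) * (ln (1 + \<rho>0\<^sup>2) + 1)"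
      using lnp by (intro mult_right_mono) (auto simp: \<epsilon>_def)
    then show ?thesis using lnp by simp
  qed
  let ?g1 = "\<lambda>s::real. (1 + s) powr (- b) * ln (1 + s)"
  let ?g1' = "\<lambda>s::real. (1 + s) powr (- b - 1) * (1 - b * ln (1 + s))"
  let ?g1'' = "\<lambda>s::real. (1 + s) powr (- b - 2) * (b * (b + 1) * ln (1 + s) - (2 * b + 1))"
  let ?g2 = "\<lambda>s::real. (1 + s) powr (- b - 1/2)"
  let ?g2' = "\<lambda>s::real. - (b + 1/2) * (1 + s) powr (- b - 3/2)"
  let ?g2'' = "\<lambda>s::real. (b + 1/2) * (b + 3/2) * (1 + s) powr (- b - 5/2)"
  let ?H1 = "\<lambda>x. prod_hess e (\<lambda>t. t) (\<lambda>t. 1) (\<lambda>t. 0) ?g1 ?g1' ?g1'' (x - e)"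
  let ?H2 = "\<lambda>x. prod_hess e (\<lambda>t. t\<^sup>2) (\<lambda>t. 2 * t) (\<lambda>t. 2) ?g2 ?g2' ?g2'' (x - e)"
  have step: "(1 + s) powr a / (1 + s) = (1 + s) powr (a - 1)" if "0 \<le> s" for s a :: real
    using that by (simp add: powr_diff)
  have h1: "has_hessian (\<lambda>x. ((x - e) \<bullet> e) * ?g1 ((x - e) \<bullet> (x - e))) ?H1"
  proof (rule has_hessian_prod)
    fix s :: real assume s: "0 \<le> s"
    have dl: "((\<lambda>s. ln (1 + s)) has_real_derivative 1 / (1 + s)) (at s)"
      using s by (auto intro!: derivative_eq_intros)
    have "(?g1 has_real_derivative (- b * (1 + s) powr (- b - 1)) * ln (1 + s) + 1 / (1 + s) * (1 + s) powr (- b)) (at s)"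
      by (intro DERIV_mult DERIV_shifted_powr s dl) simp
    then show "(?g1 has_real_derivative ?g1' s) (at s)"
      by (rule DERIV_cong) (simp add: step[OF s] algebra_simps)
    have "(?g1' has_real_derivative (- (b + 1) * (1 + s) powr (- b - 2)) * (1 - b * ln (1 + s))
        + (0 - b * (1 / (1 + s))) * (1 + s) powr (- b - 1)) (at s)"
      by (intro DERIV_mult DERIV_shifted_powr DERIV_diff DERIV_cmult DERIV_const s dl) (simp add: algebra_simps)
    then show "(?g1' has_real_derivative ?g1'' s) (at s)"
    proof (rule DERIV_cong)
      have st: "(1 + s) powr (- b - 2) = (1 + s) powr (- b - 1) / (1 + s)"
        unfolding step[OF s] by (rule arg_cong[where f = "(powr) (1 + s)"]) simp
      have st': "(0 - b * (1 / (1 + s))) * (1 + s) powr (- b - 1) = - b * (1 + s) powr (- b - 2)"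
        unfolding st by simp
      show "- (b + 1) * (1 + s) powr (- b - 2) * (1 - b * ln (1 + s)) +
          (0 - b * (1 / (1 + s))) * (1 + s) powr (- b - 1) = ?g1'' s"
        unfolding st' by (simp add: algebra_simps)
    qed
  next
    show "continuous_on {0..} ?g1''"
      by (intro continuous_on_mult continuous_on_diff continuous_on_const continuous_on_shifted_powr continuous_on_ln)
        (auto intro!: continuous_intros)
  qed auto
  have h2: "has_hessian (\<lambda>x. ((x - e) \<bullet> e)\<^sup>2 * ?g2 ((x - e) \<bullet> (x - e))) ?H2"
  proof (rule has_hessian_prod)
    fix s :: real assume s: "0 \<le> s"
    show "(?g2 has_real_derivative ?g2' s) (at s)"
      by (intro DERIV_shifted_powr s) (auto simp: algebra_simps)
    have "(?g2' has_real_derivative (- (b + 1/2) * (- (b + 3/2) * (1 + s) powr (- b - 5/2)))) (at s)"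
      by (intro DERIV_cmult DERIV_shifted_powr s) (auto simp: algebra_simps)
    then show "(?g2' has_real_derivative ?g2'' s) (at s)" by (rule DERIV_cong) (simp add: field_simps)
  next
    show "continuous_on {0..} ?g2''"
      by (intro continuous_on_mult continuous_on_const continuous_on_shifted_powr)
  qed (auto intro!: derivative_eq_intros)
  define \<phi> where "\<phi> x = \<epsilon> * ((x - e) $ k * ?g1 ((x - e) \<bullet> (x - e)) + ((x - e) $ k)\<^sup>2 * ?g2 ((x - e) \<bullet> (x - e)))" for x
  have \<phi>: "has_hessian \<phi> (\<lambda>x. \<epsilon> *\<^sub>R (?H1 x + ?H2 x))"
    using has_hessian_cmult[OF has_hessian_add[OF h1 h2], of \<epsilon>] unfolding \<phi>_def[abs_def] inner_e' .
  have \<phi>_eq: "\<phi> x = \<epsilon> * ((x - e) $ k * (1 + (x - e) \<bullet> (x - e)) powr (- b)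
      * (ln (1 + (x - e) \<bullet> (x - e)) + (x - e) $ k * (1 + (x - e) \<bullet> (x - e)) powr (- 1/2)))" for x
  proof -
    have g: "?g2 s = (1 + s) powr (- b) * (1 + s) powr (- 1/2)" for s
      by (simp flip: powr_add)
    have "t * (A * L) + t\<^sup>2 * (A * B) = t * A * (L + t * B)" for t A L B :: real
      by (simp add: algebra_simps power2_eq_square)
    then show ?thesis unfolding \<phi>_def g by simp
  qed
  have ct1: "y $ k * (1 + y \<bullet> y) powr (- 1/2) \<le> 1" for y :: "real^'n"
  proof -
    have "y $ k * (1 + y \<bullet> y) powr (- 1/2) \<le> (1 + y \<bullet> y) powr (1/2) * (1 + y \<bullet> y) powr (- 1/2)"
      by (intro mult_right_mono component_le_half_power) auto
    also have "\<dots> = (1 + y \<bullet> y) powr 0" unfolding powr_add[symmetric] by simp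
    also have "\<dots> \<le> 1" by simp
    finally show ?thesis .
  qed
  have \<sigma>1: "1 \<le> 1 + y \<bullet> y" for y :: "real^'n" by simp
  have le: "\<phi> x \<le> w x" if "\<rho>0 \<le> norm (x - e)" "0 \<le> (x - e) $ k" for x
  proof (rule exterior_comparison[OF w \<phi> \<rho>0_pos _ _ _ _ that])
    fix x assume x: "(x - e) $ k = 0"
    show "\<phi> x \<le> 0" unfolding \<phi>_def x by simp
  next
    fix x assume x: "norm (x - e) = \<rho>0" "0 \<le> (x - e) $ k"
    have s: "(x - e) \<bullet> (x - e) = \<rho>0\<^sup>2" using x(1) by (metis power2_norm_eq_inner)
    have "\<epsilon> * (ln (1 + \<rho>0\<^sup>2) + (x - e) $ k * (1 + \<rho>0\<^sup>2) powr (- 1/2)) \<le> \<epsilon> * (ln (1 + \<rho>0\<^sup>2) + 1)"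
      using ct1[of "x - e"] \<epsilon> unfolding s by (intro mult_left_mono) auto
    also note \<epsilon>2
    finally have "((x - e) $ k * (1 + \<rho>0\<^sup>2) powr (- b)) * (\<epsilon> * (ln (1 + \<rho>0\<^sup>2) + (x - e) $ k * (1 + \<rho>0\<^sup>2) powr (- 1/2)))
      \<le> ((x - e) $ k * (1 + \<rho>0\<^sup>2) powr (- b)) * c"
      using x(2) by (intro mult_left_mono) auto
    then have "\<phi> x \<le> c * (x - e) $ k * (1 + \<rho>0\<^sup>2) powr (- b)"
      unfolding \<phi>_eq s by (simp only: mult_ac)
    also have "\<dots> \<le> w x" using wc[of x] x unfolding s by simp
    finally show "\<phi> x \<le> w x" .
  next
    fix \<eta> :: real assume \<eta>: "0 < \<eta>"
    show "\<exists>\<rho>. \<forall>x. \<rho> \<le> norm (x - e) \<longrightarrow> 0 \<le> (x - e) $ k \<longrightarrow> \<phi> x \<le> \<eta>"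
    \<comment> \<open>5 = 4 + 1: the logarithm is at most four times the quarter power, and the
      quadratic term adds at most 1 to it.\<close>
    proof (intro exI[of _ "(5 * \<epsilon> / \<eta>)\<^sup>2"] allI impI)
      fix x assume x: "(5 * \<epsilon> / \<eta>)\<^sup>2 \<le> norm (x - e)" "0 \<le> (x - e) $ k"
      define \<sigma> where "\<sigma> = 1 + (x - e) \<bullet> (x - e)"
      have \<sigma>: "1 \<le> \<sigma>" using \<sigma>1 by (simp add: \<sigma>_def)
      have "1 \<le> \<sigma> powr (1/4)" using \<sigma> by (simp add: ge_one_powr_ge_zero)
      moreover have "ln \<sigma> \<le> 4 * \<sigma> powr (1/4)" using ln_powr_bound[OF \<sigma>, of "1/4"] by simp
      ultimately have l: "ln \<sigma> + (x - e) $ k * \<sigma> powr (- 1/2) \<le> 5 * \<sigma> powr (1/4)"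
        using ct1[of "x - e"] unfolding \<sigma>_def by linarith
      have "(x - e) $ k * \<sigma> powr (- b) * (ln \<sigma> + (x - e) $ k * \<sigma> powr (- 1/2))
        \<le> \<sigma> powr (1/2) * \<sigma> powr (- b) * (5 * \<sigma> powr (1/4))"
        using component_le_half_power[of "x - e" k] l x(2) \<sigma> unfolding \<sigma>_def[symmetric]
        by (intro mult_mono mult_right_mono add_nonneg_nonneg mult_nonneg_nonneg) auto
      also have "\<dots> = 5 * \<sigma> powr (3/4 - b)" by (simp flip: powr_add)
      also have "\<dots> \<le> 5 * \<sigma> powr (- 1/4)"
        using powr_mono[of "3/4 - b" "- 1/4" \<sigma>] b_ge \<sigma> by auto
      finally have "\<phi> x \<le> 5 * \<epsilon> * \<sigma> powr (- 1/4)" using \<epsilon> unfolding \<phi>_eq \<sigma>_def by simp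
      also have "\<dots> \<le> \<eta>" using quarter_power_decay[OF _ \<eta> x(1)] \<epsilon> by (simp add: \<sigma>_def)
      finally show "\<phi> x \<le> \<eta>" .
    qed
  next
    fix x assume x: "\<rho>0 < norm (x - e)" "0 < (x - e) $ k"
    obtain \<theta> where th: "norm \<theta> = 1" "x - e = norm (x - e) *\<^sub>R \<theta>" by (rule polar_decomposition)
    define s where "s = (x - e) \<bullet> (x - e)"
    define t where "t = (x - e) $ k"
    \<comment> \<open>All contributions share the factor W, the remaining dependence being on the
      slope variable r in (0, 1], which is small near the flat boundary.\<close>
    define W where "W = (1 + s) powr (- b - 1/2)"
    define r where "r = t * (1 + s) powr (- 1/2)"
    have s: "0 \<le> s" by (simp add: s_def)
    have t: "0 < t" using x by (simp add: t_def)
    have W: "0 < W" using s by (simp add: W_def)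
    have r: "0 < r" using t s by (simp add: r_def)
    have r1: "r \<le> 1" using ct1[of "x - e"] unfolding r_def s_def t_def .
    have e1: "t * (1 + s) powr (- b - 1) = r * W"
    proof -
      have "(1 + s) powr (- b - 1) = (1 + s) powr (- 1/2) * W"
        unfolding W_def powr_add[symmetric] by (rule arg_cong[where f = "(powr) (1 + s)"]) simp
      then show ?thesis by (simp add: r_def)
    qed
    have e2: "t\<^sup>2 * (1 + s) powr (- b - 3/2) = r\<^sup>2 * W"
    proof -
      have "(1 + s) powr (- b - 3/2) = (1 + s) powr (- 1/2) * (1 + s) powr (- 1/2) * W"
        unfolding W_def powr_add[symmetric] by (rule arg_cong[where f = "(powr) (1 + s)"]) simp
      then show ?thesis by (simp add: r_def power2_eq_square)
    qed
    have e3: "(c * t * (1 + s) powr (- b)) powr p = c powr p * r powr p * W"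
    proof -
      \<comment> \<open>This is where criticality enters: it gives the source exactly the same power
        W of 1 + s.\<close>
      have pb: "p * b = b + 1/2 + p / 2" using p(2) by (simp add: b_def field_simps)
      have "t = r * (1 + s) powr (1/2)"
      proof -
        have "(1 + s) powr (- 1/2) * (1 + s) powr (1/2) = 1" using s unfolding powr_add[symmetric] by simp
        then show ?thesis by (simp add: r_def mult.assoc)
      qed
      then have "c * t * (1 + s) powr (- b) = c * r * ((1 + s) powr (1/2) * (1 + s) powr (- b))" by simp
      also have "(1 + s) powr (1/2) * (1 + s) powr (- b) = (1 + s) powr (1/2 - b)" by (simp flip: powr_add)
      also have "(c * r * (1 + s) powr (1/2 - b)) powr p = c powr p * r powr p * (1 + s) powr ((1/2 - b) * p)"
        using c r s by (simp add: powr_mult powr_powr)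
      also have "(1/2 - b) * p = - b - 1/2" using pb by (simp add: algebra_simps)
      finally show ?thesis by (simp add: W_def)
    qed
    have "lin_op lam Lam \<theta> (?H1 x) = 2 * Lam * t * ((2 * b + 2) * ?g1' s + 2 * s * ?g1'' s)"
      unfolding lin_op_linear_times_radial[OF th] t_def s_def ..
    also have "\<dots> \<ge> 2 * Lam * t * (- 2 * b * (b + 2) * (1 + s) powr (- b - 1))"
      using log_barrier_coefficient_ge[OF b_ge s] Lam_pos t by (intro mult_left_mono) auto
    also have "2 * Lam * t * (- 2 * b * (b + 2) * (1 + s) powr (- b - 1)) = - (4 * Lam * b * (b + 2)) * (r * W)"
      unfolding e1[symmetric] by (simp add: algebra_simps)
    finally have L1: "- (4 * Lam * b * (b + 2)) * (r * W) \<le> lin_op lam Lam \<theta> (?H1 x)" .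
    have "lin_op lam Lam \<theta> (?H2 x) = 2 * W * (lam + (Lam - lam) * (\<theta> $ k)\<^sup>2)
        - 2 * Lam * (4 + 2 * b) * (b + 1/2) * (t\<^sup>2 * (1 + s) powr (- b - 3/2)) + 4 * Lam * t\<^sup>2 * ?g2'' s * s"
      unfolding lin_op_square_times_radial[OF th] t_def[symmetric] s_def[symmetric] W_def
      by (simp only: mult_minus_left mult_minus_right diff_conv_add_uminus mult_ac)
    moreover have "4 * Lam * t\<^sup>2 * ?g2'' s * s \<ge> 0" using s Lam_pos b_ge by (intro mult_nonneg_nonneg) auto
    moreover have "2 * W * lam \<le> 2 * W * (lam + (Lam - lam) * (\<theta> $ k)\<^sup>2)"
      using W lam_le by (intro mult_left_mono) auto
    ultimately have L2: "2 * W * lam - 2 * Lam * (4 + 2 * b) * (b + 1/2) * (r\<^sup>2 * W) \<le> lin_op lam Lam \<theta> (?H2 x)"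
      unfolding e2 by linarith
    have "r\<^sup>2 \<le> r" using r r1 by (simp add: power2_eq_square mult_left_le)
    then have "2 * Lam * (4 + 2 * b) * (b + 1/2) * (r\<^sup>2 * W) \<le> 2 * Lam * (4 + 2 * b) * (b + 1/2) * (r * W)"
      using W Lam_pos b_ge by (intro mult_left_mono mult_right_mono) auto
    then have "W * (2 * lam - C * r) \<le> lin_op lam Lam \<theta> (?H1 x) + lin_op lam Lam \<theta> (?H2 x)"
      using L1 L2 unfolding C_def by (simp add: algebra_simps)
    then have "\<epsilon> * (W * (2 * lam - C * r)) \<le> lin_op lam Lam \<theta> (\<epsilon> *\<^sub>R (?H1 x + ?H2 x))"
      unfolding lin_op_scaleR lin_op_add using \<epsilon> by simp
    moreover have "c powr p * r powr p * W \<le> z x powr p"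
    proof -
      have "c * t * (1 + s) powr (- b) \<le> z x" using zc[of x] x unfolding t_def s_def by auto
      then have "(c * t * (1 + s) powr (- b)) powr p \<le> z x powr p"
        using c t p by (intro powr_mono2) auto
      then show ?thesis by (simp add: e3)
    qed
    moreover have "0 < \<epsilon> * (W * (2 * lam - C * r)) + c powr p * r powr p * W"
    proof -
      have "0 < \<epsilon> * (2 * lam - C * r) + c powr p * r powr p"
      \<comment> \<open>Near the flat boundary the quadratic term retains at least lam; away from it
        the source outweighs C by the choice of \<epsilon>.\<close>
      proof (cases "r \<le> c0")
        case True
        then have "C * r \<le> lam" using C by (simp add: c0_def field_simps)
        then have "0 < \<epsilon> * (2 * lam - C * r)" using \<epsilon> lam_pos by simp
        then show ?thesis by (simp add: add_pos_nonneg)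
      next
        case False
        then have "c powr p * c0 powr p \<le> c powr p * r powr p" using c0 p by (intro mult_left_mono powr_mono2) auto
        moreover have "\<epsilon> * (C * r) \<le> \<epsilon> * C" using \<epsilon> C r1 by simp
        moreover have "0 < \<epsilon> * (2 * lam)" using \<epsilon> lam_pos by simp
        ultimately show ?thesis using \<epsilon>1 by (simp add: right_diff_distrib)
      qed
      with W have "0 < W * (\<epsilon> * (2 * lam - C * r) + c powr p * r powr p)" by simp
      then show ?thesis by (simp add: algebra_simps)
    qed
    ultimately show "0 < pucci_max lam Lam (hessian \<phi> x) + z x powr p"
      using lin_op_le_pucci_max_hessian[OF \<phi> lam_pos lam_le th(1), of x] by linarith
  qed
  show ?thesis
  proof (intro exI[of _ \<epsilon>] conjI \<epsilon> allI impI)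
    fix x assume x: "\<rho>0 \<le> norm (x - e)" "0 \<le> (x - e) $ k"
    have "\<epsilon> * (x - e) $ k * (1 + (x - e) \<bullet> (x - e)) powr (- b) * ln (1 + (x - e) \<bullet> (x - e)) \<le> \<phi> x"
      unfolding \<phi>_def mult.assoc using \<epsilon> by (intro mult_left_mono) auto
    with le[OF x] show "\<epsilon> * (x - e) $ k * (1 + (x - e) \<bullet> (x - e)) powr (- b) * ln (1 + (x - e) \<bullet> (x - e)) \<le> w x" by linarith
  qed
qed

end

subsection \<open>Nonexistence\<close>

context pucci_half_space
begin

section \<open>Minima over the balls about R e_n\<close>

lemma minimum_on_ball:
  assumes u: "is_supersol u f" and pos: "\<And>x. x \<in> S \<Longrightarrow> 0 < u x" and R: "0 < R"
  obtains x0 where "x0 \<in> cball (R *\<^sub>R e) (R / 2)" "0 < u x0"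
    "\<And>x. x \<in> cball (R *\<^sub>R e) (R / 2) \<Longrightarrow> u x0 \<le> u x"
proof -
  let ?B = "cball (R *\<^sub>R e) (R / 2)"
  have BS: "?B \<subseteq> S" using R by (intro cball_subset_S) simp
  then have c: "continuous_on ?B u" using u continuous_on_subset by (auto simp: is_supersol_def)
  have "?B \<noteq> {}" using R by simp
  from continuous_attains_inf[OF compact_cball this c]
  obtain x0 where x0: "x0 \<in> ?B" and mn: "\<forall>x\<in>?B. u x0 \<le> u x" by blast
  show ?thesis
    using x0 mn BS by (intro that[of x0] pos) auto
qed

text \<open>Two passes of \<open>scaled_ball_lower_bound\<close>: the minimum of u feeds the
  equation of v, and the resulting bound V feeds the equation of u, evaluated at the
  minimiser.\<close>

lemma minimum_inequality:
  assumes u: "is_supersol u (\<lambda>x. v x powr p)" and v: "is_supersol v (\<lambda>x. u x powr q)"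
    and pq: "p > 0" "q > 0" and R: "0 < R"
    and x0: "x0 \<in> cball (R *\<^sub>R e) (R / 2)" "0 < u x0"
    and mn: "\<And>x. x \<in> cball (R *\<^sub>R e) (R / 2) \<Longrightarrow> u x0 \<le> u x"
  shows "ball_const powr (1 + p) * R powr (2 + 2 * p) * u x0 powr (p * q) \<le> u x0"
proof -
  define V where "V = ball_const * R\<^sup>2 * u x0 powr q"
  have V: "0 < V" using ball_const_pos R x0 by (simp add: V_def)
  have "V \<le> v x" if "x \<in> cball (R *\<^sub>R e) (R / 2)" for x
    unfolding V_def
  proof (rule scaled_ball_lower_bound[OF v R _ _ that])
    show "u x0 powr q \<le> u x powr q" if "x \<in> cball (R *\<^sub>R e) (R / 2)" for x
      using mn[OF that] x0 pq by (intro powr_mono2) auto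
  qed (use x0 in simp)
  then have "V powr p \<le> v x powr p" if "x \<in> cball (R *\<^sub>R e) (R / 2)" for x
    using that V pq by (intro powr_mono2) auto
  then have "ball_const * R\<^sup>2 * V powr p \<le> u x0"
    using V by (intro scaled_ball_lower_bound[OF u R _ _ x0(1)]) auto
  moreover have "V powr p = ball_const powr p * R powr (2 * p) * u x0 powr (p * q)"
    using ball_const_pos R by (simp add: V_def powr_mult powr_powr mult.commute flip: powr_numeral)
  moreover have "ball_const powr (1 + p) = ball_const * ball_const powr p"
    using ball_const_pos by (simp add: powr_add)
  moreover have "R powr (2 + 2 * p) = R\<^sup>2 * R powr (2 * p)"
    using R by (simp add: powr_add)
  ultimately show ?thesis by (simp only: mult_ac)
qed

text \<open>Translates barriers centred at e into powers of R: on the ball the height above e is at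
  least R / 4 and the distance to e at most 2 R, so 1 + |x - e|^2 lies between R and 5 R^2.\<close>

lemma cone_ball_geometry:
  assumes R: "4 * \<rho>0 \<le> R" and x: "x \<in> cball (R *\<^sub>R e) (R / 2)"
  shows "\<rho>0 \<le> norm (x - e)" "0 \<le> (x - e) $ k" "ln R \<le> ln (1 + (x - e) \<bullet> (x - e))"
    "5 powr (- b) / 4 * R powr (1 - nt) \<le> (x - e) $ k * (1 + (x - e) \<bullet> (x - e)) powr (- b)"
proof -
  have R48: "48 \<le> R" using R nt_ge by (simp add: \<rho>0_def)
  have "\<bar>(x - R *\<^sub>R e) $ k\<bar> \<le> R / 2"
    using x component_le_norm_cart[of "x - R *\<^sub>R e" k] by (simp add: dist_norm norm_minus_commute)
  then have "\<bar>x $ k - R\<bar> \<le> R / 2" by simp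
  then have "R / 2 \<le> x $ k" by linarith
  then have t: "R / 4 \<le> (x - e) $ k" using R48 by simp
  also have tn: "(x - e) $ k \<le> norm (x - e)" using component_le_norm_cart[of "x - e" k] by linarith
  finally have n: "R / 4 \<le> norm (x - e)" .
  then show "\<rho>0 \<le> norm (x - e)" using R by linarith
  show "0 \<le> (x - e) $ k" using t R48 by linarith
  have sq: "(x - e) \<bullet> (x - e) = (norm (x - e))\<^sup>2" by (simp add: power2_norm_eq_inner)
  have "(R / 4)\<^sup>2 \<le> (norm (x - e))\<^sup>2" using n R48 by (intro power_mono) auto
  moreover have "R * 16 \<le> R * R" using R48 by (intro mult_left_mono) auto
  ultimately have "R \<le> 1 + (x - e) \<bullet> (x - e)" unfolding sq by (simp add: power2_eq_square)
  then show "ln R \<le> ln (1 + (x - e) \<bullet> (x - e))" using R48 by simp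
  have "norm (x - e) \<le> norm (x - R *\<^sub>R e) + norm (R *\<^sub>R e - e)"
    using norm_triangle_ineq[of "x - R *\<^sub>R e" "R *\<^sub>R e - e"] by simp
  also have "R *\<^sub>R e - e = (R - 1) *\<^sub>R e" by (simp add: algebra_simps)
  finally have "norm (x - e) \<le> 2 * R" using x R48 by (simp add: dist_norm norm_minus_commute)
  then have "(norm (x - e))\<^sup>2 \<le> (2 * R)\<^sup>2" by (intro power_mono) auto
  moreover have "1 * 1 \<le> R * R" using R48 by (intro mult_mono) auto
  ultimately have "1 + (x - e) \<bullet> (x - e) \<le> 5 * R\<^sup>2" unfolding sq by (simp add: power2_eq_square)
  then have "(5 * R\<^sup>2) powr (- b) \<le> (1 + (x - e) \<bullet> (x - e)) powr (- b)"
    using b_ge by (intro powr_mono2') (auto simp: add_pos_nonneg)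
  then have "R / 4 * (5 * R\<^sup>2) powr (- b) \<le> (x - e) $ k * (1 + (x - e) \<bullet> (x - e)) powr (- b)"
    using t R48 by (intro mult_mono) auto
  moreover have "R / 4 * (5 * R\<^sup>2) powr (- b) = 5 powr (- b) / 4 * R powr (1 - nt)"
  proof -
    have "(5 * R\<^sup>2) powr (- b) = 5 powr (- b) * (R powr 2) powr (- b)"
      using R48 by (simp add: powr_mult)
    also have "(R powr 2) powr (- b) = R powr (- nt)" by (simp add: powr_powr b_def)
    finally have A: "(5 * R\<^sup>2) powr (- b) = 5 powr (- b) * R powr (- nt)" .
    have B: "R powr (1 - nt) = R * R powr (- nt)" using powr_add[of R 1 "- nt"] R48 by simp
    show ?thesis unfolding A B by simp
  qed
  ultimately show "5 powr (- b) / 4 * R powr (1 - nt) \<le> (x - e) $ k * (1 + (x - e) \<bullet> (x - e)) powr (- b)" by simp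
qed

section \<open>Contradictions for large R in the three regimes\<close>

lemma no_positive_pair_critical_product:
  assumes u: "is_supersol u (\<lambda>x. v x powr p)" and v: "is_supersol v (\<lambda>x. u x powr q)"
    and pq: "p > 0" "q > 0" "p * q = 1" and pos: "\<And>x. x \<in> S \<Longrightarrow> 0 < u x"
  shows False
proof -
  define K where "K = ball_const powr (1 + p)"
  have K: "0 < K" using ball_const_pos by (simp add: K_def)
  \<comment> \<open>Chosen so that K R = K + 1 exceeds 1; R \<ge> 1 lets the higher power of R
    dominate R.\<close>
  define R where "R = 1 + 1 / K"
  have R: "1 \<le> R" using K by (simp add: R_def)
  then have "0 < R" by linarith
  obtain x0 where x0: "x0 \<in> cball (R *\<^sub>R e) (R / 2)" "0 < u x0"
    "\<And>x. x \<in> cball (R *\<^sub>R e) (R / 2) \<Longrightarrow> u x0 \<le> u x"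
    using minimum_on_ball[OF u pos \<open>0 < R\<close>] by blast
  have "K * R powr (2 + 2 * p) \<le> 1"
    using minimum_inequality[OF u v pq(1,2) \<open>0 < R\<close> x0] x0(2) pq by (simp add: K_def)
  moreover have "R \<le> R powr (2 + 2 * p)" using powr_mono[of 1 "2 + 2 * p" R] R pq by simp
  then have "K * R \<le> K * R powr (2 + 2 * p)" using K by simp
  ultimately show False using K by (simp add: R_def distrib_left)
qed

text \<open>Upper and lower bounds on the minimum meet here, and the sign of the exponent of R
  decides. R is fixed, so l may depend on it; the critical case inserts a multiple of ln R.\<close>

lemma minimum_decay:
  assumes u: "is_supersol u (\<lambda>x. v x powr p)" and v: "is_supersol v (\<lambda>x. u x powr q)"
    and pq: "p > 0" "q > 0" "p * q > 1" and pos: "\<And>x. x \<in> S \<Longrightarrow> 0 < u x"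
    and R: "0 < R" and l: "0 < l"
    and lower: "\<And>x. x \<in> cball (R *\<^sub>R e) (R / 2) \<Longrightarrow> l * R powr (1 - nt) \<le> u x"
  shows "ball_const powr (1 + p) * l powr (p * q - 1) * R powr (2 * (p + 1) - (nt - 1) * (p * q - 1)) \<le> 1"
proof -
  obtain x0 where x0: "x0 \<in> cball (R *\<^sub>R e) (R / 2)" "0 < u x0"
    "\<And>x. x \<in> cball (R *\<^sub>R e) (R / 2) \<Longrightarrow> u x0 \<le> u x"
    using minimum_on_ball[OF u pos R] by blast
  define d where "d = p * q - 1"
  have d: "0 < d" using pq by (simp add: d_def)
  have K: "0 < ball_const powr (1 + p)" using ball_const_pos by simp
  have "u x0 powr (p * q) = u x0 powr d * u x0"
    using x0(2) by (simp add: d_def powr_diff)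
  then have *: "ball_const powr (1 + p) * R powr (2 + 2 * p) * u x0 powr d \<le> 1"
    using minimum_inequality[OF u v pq(1,2) R x0] x0(2) by (simp flip: mult.assoc)
  have "(l * R powr (1 - nt)) powr d \<le> u x0 powr d"
    using lower[OF x0(1)] l R d by (intro powr_mono2) auto
  moreover have "(l * R powr (1 - nt)) powr d = l powr d * R powr ((1 - nt) * d)"
    using l R by (simp add: powr_mult powr_powr)
  ultimately have "ball_const powr (1 + p) * R powr (2 + 2 * p) * (l powr d * R powr ((1 - nt) * d))
      \<le> ball_const powr (1 + p) * R powr (2 + 2 * p) * u x0 powr d"
    using K by (intro mult_left_mono) auto
  also note *
  finally have "ball_const powr (1 + p) * l powr d * (R powr (2 + 2 * p) * R powr ((1 - nt) * d)) \<le> 1"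
    by (simp only: mult_ac)
  also have "R powr (2 + 2 * p) * R powr ((1 - nt) * d) = R powr (2 * (p + 1) - (nt - 1) * d)"
    unfolding powr_add[symmetric] by (rule arg_cong[where f = "(powr) R"]) (simp add: algebra_simps)
  finally show ?thesis unfolding d_def .
qed

lemma no_positive_pair_subcritical:
  assumes u: "is_supersol u (\<lambda>x. v x powr p)" and v: "is_supersol v (\<lambda>x. u x powr q)"
    and pq: "p > 0" "q > 0" "p * q > 1" "(nt - 1) * (p * q - 1) < 2 * (p + 1)"
    and pos: "\<And>x. x \<in> S \<Longrightarrow> 0 < u x"
  shows False
proof -
  obtain c where c: "0 < c" and uc: "\<And>x. \<rho>0 \<le> norm (x - e) \<Longrightarrow> 0 \<le> (x - e) $ k \<Longrightarrow>
        c * (x - e) $ k * (1 + (x - e) \<bullet> (x - e)) powr (- b) \<le> u x"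
    using exterior_lower_bound[OF u pos] by blast
  define l where "l = c * (5 powr (- b) / 4)"
  have l: "0 < l" using c by (simp add: l_def)
  define \<theta> where "\<theta> = 2 * (p + 1) - (nt - 1) * (p * q - 1)"
  have \<theta>: "0 < \<theta>" using pq by (simp add: \<theta>_def)
  define K where "K = ball_const powr (1 + p) * l powr (p * q - 1)"
  have K: "0 < K" using ball_const_pos l by (simp add: K_def)
  \<comment> \<open>The first entry places the ball in the range of the exterior bound; the second
    makes K R^\<theta> at least K + 1.\<close>
  define R where "R = max (4 * \<rho>0) ((1 + 1 / K) powr (1 / \<theta>))"
  have R: "0 < R" "4 * \<rho>0 \<le> R" using \<rho>0_pos by (auto simp: R_def)
  have "K * R powr \<theta> \<le> 1"
    unfolding K_def \<theta>_def
  proof (rule minimum_decay[OF u v pq(1-3) pos R(1) l])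
    fix x assume x: "x \<in> cball (R *\<^sub>R e) (R / 2)"
    have "l * R powr (1 - nt) \<le> c * ((x - e) $ k * (1 + (x - e) \<bullet> (x - e)) powr (- b))"
      using cone_ball_geometry(4)[OF R(2) x] c unfolding l_def mult.assoc by (intro mult_left_mono) auto
    also have "\<dots> \<le> u x" using uc[OF cone_ball_geometry(1,2)[OF R(2) x]] by (simp only: mult.assoc)
    finally show "l * R powr (1 - nt) \<le> u x" .
  qed
  moreover have "1 + 1 / K \<le> R powr \<theta>"
  proof -
    have "((1 + 1 / K) powr (1 / \<theta>)) powr \<theta> \<le> R powr \<theta>"
      using \<theta> by (intro powr_mono2) (auto simp: R_def)
    moreover have "0 < 1 + 1 / K" using K by (simp add: add_pos_pos)
    ultimately show ?thesis using \<theta> by (simp add: powr_powr)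
  qed
  then have "K * (1 + 1 / K) \<le> K * R powr \<theta>" using K by (intro mult_left_mono) auto
  ultimately show False using K by (simp add: distrib_left)
qed

text \<open>With p = q the power of R in \<open>minimum_decay\<close> is R^0, so the plain exterior
  bound gives no contradiction; the gain of \<open>log_lower_bound\<close> leaves an unbounded power
  of ln R.\<close>

lemma no_positive_pair_critical:
  assumes u: "is_supersol u (\<lambda>x. v x powr p)" and v: "is_supersol v (\<lambda>x. u x powr p)"
    and p: "p > 1" "(nt - 1) * (p - 1) = 2"
    and pos: "\<And>x. x \<in> S \<Longrightarrow> 0 < u x" "\<And>x. x \<in> S \<Longrightarrow> 0 < v x"
  shows False
proof -
  obtain c1 where c1: "0 < c1" and uc: "\<And>x. \<rho>0 \<le> norm (x - e) \<Longrightarrow> 0 \<le> (x - e) $ k \<Longrightarrow>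
        c1 * (x - e) $ k * (1 + (x - e) \<bullet> (x - e)) powr (- b) \<le> u x"
    using exterior_lower_bound[OF u pos(1)] by blast
  obtain c2 where c2: "0 < c2" and vc: "\<And>x. \<rho>0 \<le> norm (x - e) \<Longrightarrow> 0 \<le> (x - e) $ k \<Longrightarrow>
        c2 * (x - e) $ k * (1 + (x - e) \<bullet> (x - e)) powr (- b) \<le> v x"
    using exterior_lower_bound[OF v pos(2)] by blast
  define c where "c = min c1 c2"
  have c: "0 < c" using c1 c2 by (simp add: c_def)
  have mono: "c * (x - e) $ k * (1 + (x - e) \<bullet> (x - e)) powr (- b) \<le> c' * (x - e) $ k * (1 + (x - e) \<bullet> (x - e)) powr (- b)"
    if "c \<le> c'" "0 \<le> (x - e) $ k" for c' x
    using that by (intro mult_right_mono) auto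
  have "p * (nt - 1) = nt + 1" using p(2) by (simp add: algebra_simps)
  moreover have "c * (x - e) $ k * (1 + (x - e) \<bullet> (x - e)) powr (- b) \<le> u x"
    "c * (x - e) $ k * (1 + (x - e) \<bullet> (x - e)) powr (- b) \<le> v x"
    if "\<rho>0 \<le> norm (x - e)" "0 \<le> (x - e) $ k" for x
    using order_trans[OF mono uc] order_trans[OF mono vc] that unfolding c_def by (meson min.cobounded1 min.cobounded2)+
  moreover have "0 < p" using p by simp
  ultimately obtain \<epsilon> where \<epsilon>: "0 < \<epsilon>" and ue: "\<And>x. \<rho>0 \<le> norm (x - e) \<Longrightarrow> 0 \<le> (x - e) $ k \<Longrightarrow>
      \<epsilon> * (x - e) $ k * (1 + (x - e) \<bullet> (x - e)) powr (- b) * ln (1 + (x - e) \<bullet> (x - e)) \<le> u x"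
    using log_lower_bound[OF u _ _ c] by blast
  have pp: "1 < p * p" using p less_1_mult by blast
  define l where "l = \<epsilon> * (5 powr (- b) / 4)"
  have l: "0 < l" using \<epsilon> by (simp add: l_def)
  define K where "K = ball_const powr (1 + p) * l powr (p * p - 1)"
  have K: "0 < K" using ball_const_pos l by (simp add: K_def)
  define R where "R = max (4 * \<rho>0) (exp ((1 + 1 / K) powr (1 / (p * p - 1))))"
  have R: "0 < R" "4 * \<rho>0 \<le> R" using \<rho>0_pos by (auto simp: R_def)
  have lnR: "(1 + 1 / K) powr (1 / (p * p - 1)) \<le> ln R"
    using R(1) by (subst ln_ge_iff) (auto simp: R_def)
  have K1: "0 < 1 + 1 / K" using K by (simp add: add_pos_pos)
  then have lnR0: "0 < ln R" using lnR by (smt (verit) powr_gt_zero)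
  have "ball_const powr (1 + p) * (l * ln R) powr (p * p - 1) * R powr (2 * (p + 1) - (nt - 1) * (p * p - 1)) \<le> 1"
  proof (rule minimum_decay[OF u v _ _ pp pos(1) R(1)])
    fix x assume x: "x \<in> cball (R *\<^sub>R e) (R / 2)"
    let ?A = "(x - e) $ k * (1 + (x - e) \<bullet> (x - e)) powr (- b)"
    have "l * R powr (1 - nt) \<le> \<epsilon> * ?A"
      using cone_ball_geometry(4)[OF R(2) x] \<epsilon> unfolding l_def mult.assoc by (intro mult_left_mono) auto
    then have "l * R powr (1 - nt) * ln R \<le> \<epsilon> * ?A * ln (1 + (x - e) \<bullet> (x - e))"
    proof (rule mult_mono[OF _ cone_ball_geometry(3)[OF R(2) x]])
      show "0 \<le> \<epsilon> * ?A" using cone_ball_geometry(2)[OF R(2) x] \<epsilon> by simp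
    qed (use lnR0 in simp)
    also have "\<dots> \<le> u x" using ue[OF cone_ball_geometry(1,2)[OF R(2) x]] by (simp only: mult.assoc)
    finally show "l * ln R * R powr (1 - nt) \<le> u x" by (simp only: mult_ac)
  qed (use p l lnR0 in auto)
  moreover have "2 * (p + 1) - (nt - 1) * (p * p - 1) = 0"
  proof -
    have "(nt - 1) * (p * p - 1) = (nt - 1) * (p - 1) * (p + 1)" by (simp add: algebra_simps)
    then show ?thesis by (simp add: p(2))
  qed
  ultimately have "K * ln R powr (p * p - 1) \<le> 1"
    using R(1) l lnR0 by (simp add: K_def powr_mult mult_ac)
  moreover have "1 + 1 / K \<le> ln R powr (p * p - 1)"
  proof -
    have "((1 + 1 / K) powr (1 / (p * p - 1))) powr (p * p - 1) \<le> ln R powr (p * p - 1)"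
      using pp lnR by (intro powr_mono2) auto
    then show ?thesis using pp K1 by (simp add: powr_powr)
  qed
  then have "K * (1 + 1 / K) \<le> K * ln R powr (p * p - 1)" using K by (intro mult_left_mono) auto
  ultimately show False using K by (simp add: distrib_left)
qed

end

theorem theorem4:
  fixes k :: "'n::finite" and lam Lam p q nt :: real
  assumes "CARD('n) \<ge> 2"
    and "0 < lam" and "lam \<le> Lam"
    and "nt = lam / Lam * (real CARD('n) - 1) + 1"
    and "nt \<ge> 2"
    and "p > 0" and "q > 0"
    and "(p * q > 1 \<and> (2 * (p + 1) / (p * q - 1) > nt - 1 \<or> 2 * (q + 1) / (p * q - 1) > nt - 1))
       \<or> (2 * (p + 1) / (p * q - 1) = nt - 1 \<and> 2 * (q + 1) / (p * q - 1) = nt - 1)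
       \<or> p * q = 1"
  shows "\<not> (\<exists>u v :: real ^ 'n \<Rightarrow> real.
            nonneg_supersolution lam Lam p q (half_space k) u v \<and>
            \<not> (\<forall>x\<in>half_space k. u x = 0 \<and> v x = 0))"
proof
  assume "\<exists>u v :: real ^ 'n \<Rightarrow> real.
            nonneg_supersolution lam Lam p q (half_space k) u v \<and>
            \<not> (\<forall>x\<in>half_space k. u x = 0 \<and> v x = 0)"
  then obtain u v :: "real^'n \<Rightarrow> real" and x1 where
    sol: "nonneg_supersolution lam Lam p q (half_space k) u v"
    and x1: "x1 \<in> half_space k" "u x1 \<noteq> 0 \<or> v x1 \<noteq> 0" by blast
  interpret pucci_half_space k lam Lam nt
    using assms(2-5) by unfold_locales (auto simp: field_simps)
  have u: "is_supersol u (\<lambda>x. v x powr p)" and v: "is_supersol v (\<lambda>x. u x powr q)"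
    using sol by (auto simp: nonneg_supersolution_def is_supersol_def)
  have pos: "\<And>x. x \<in> S \<Longrightarrow> 0 < u x" "\<And>x. x \<in> S \<Longrightarrow> 0 < v x"
    using both_positive[OF u v assms(6,7) x1] by blast+
  have qp: "q * p = p * q" by simp
  consider "p * q > 1" "2 * (p + 1) / (p * q - 1) > nt - 1"
    | "p * q > 1" "2 * (q + 1) / (p * q - 1) > nt - 1"
    | "2 * (p + 1) / (p * q - 1) = nt - 1" "2 * (q + 1) / (p * q - 1) = nt - 1"
    | "p * q = 1" using assms(8) by blast
  then show False
  proof cases
    case 1
    then show False
      using no_positive_pair_subcritical[OF u v assms(6,7) _ _ pos(1)] by (simp add: pos_less_divide_eq)
  next
    case 2
    then show False
      using no_positive_pair_subcritical[OF v u assms(7,6) _ _ pos(2)] unfolding qp by (simp add: pos_less_divide_eq)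
  next
    case 3
    \<comment> \<open>This case does not presuppose p q > 1. Otherwise the quotient would be at most
      0, including the value 0 of a division by zero, while nt - 1 \<ge> 1.\<close>
    have d: "0 < p * q - 1"
    proof (rule ccontr)
      assume "\<not> 0 < p * q - 1"
      then have "2 * (p + 1) / (p * q - 1) \<le> 0" using assms(6) by (intro divide_nonneg_nonpos) auto
      then show False using 3 assms(5) by linarith
    qed
    then have e: "2 * (p + 1) = (nt - 1) * (p * q - 1)" "2 * (q + 1) = (nt - 1) * (p * q - 1)"
      using 3 by (simp_all add: divide_eq_eq)
    then have "2 * (q + 1) = 2 * (p + 1)" by simp
    then have qeq: "q = p" by simp
    have p1: "1 < p"
    proof (rule ccontr)
      assume "\<not> 1 < p"
      then have "p * p \<le> 1" using assms(6) by (simp add: mult_le_one)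
      then show False using d qeq by simp
    qed
    have "(p + 1) * ((nt - 1) * (p - 1)) = (p + 1) * 2" using e(1) qeq by (simp add: algebra_simps)
    then have "(nt - 1) * (p - 1) = 2" using assms(6) by (subst (asm) mult_left_cancel) auto
    then show False using no_positive_pair_critical[OF u _ p1 _ pos] v qeq by simp
  next
    case 4
    then show False using no_positive_pair_critical_product[OF u v assms(6,7) _ pos(1)] by blast
  qed
qed

end
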